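(* Let $q>3$ be a prime power and let $d$ be a nonnegative integer. (a) If $d\le q-2$, then the ideal $$\mathcal{I}_{q,d}:=\mathcal{I}_q+\langle x_i\colon i>d\rangle+\langle x_d^{q-1}-1\rangle\subset\mathbb{F}_q[X_q]$$ is zero-dimensional and radical, and $\mathcal{P}_{q,d}$ is identified with its algebraic set $\mathcal{Z}(\mathcal{I}_{q,d})$, via the bijection $(s_0,\ldots,s_{q-2})\mapsto\sum_{i=0}^{q-2}s_ix^i$. In particular, $|\mathcal{P}_{q,d}|=|\mathcal{Z}(\mathcal{I}_{q,d})|=\dim_{\mathbb{F}_q}(\mathbb{F}_q[X_q]/\mathcal{I}_{q,d})$. (b) The ideal $$\mathcal{J}_{q,d}:=\mathcal{J}_q+\langle x_{ij}\colon i+j>d\rangle+\Big\langle\prod_{i+j=d}(x_{ij}^{q-1}-1)\Big\rangle\subset\mathbb{F}_q[\overline{X}_q]$$ is zero-dimensional and radical, and $\mathcal{LP}_{q,d}$ is identified with its algebraic set $\mathcal{Z}(\mathcal{J}_{q,d})$, via the bijection $(s_{ij})_{0\le i,j\le q-2}\mapsto\sum_{i,j=0}^{q-2}s_{ij}x^iy^j$. As a consequence, $|\mathcal{LP}_{q,d}|=|\mathcal{Z}(\mathcal{J}_{q,d})|=\dim_{\mathbb{F}_q}(\mathbb{F}_q[\overline{X}_q]/\mathcal{J}_{q,d})$.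
   Context: $\mathbb{F}_q$ is the finite field with $q$ elements. $\mathcal{P}_q$ is the set of permutation polynomials: polynomials in $\mathbb{F}_q[x]$ of degree less than $q$ that act as permutations of $\mathbb{F}_q$; $\mathcal{P}_{q,d}$ is the subset of those of degree $d$. $\mathcal{LP}_q$ is the set of local permutation polynomials: polynomials $f\in\mathbb{F}_q[x,y]$ of degree less than $q$ in each variable such that, for every $a\in\mathbb{F}_q$, both $f(x,a)$ and $f(a,x)$ act as permutations of $\mathbb{F}_q$; $\mathcal{LP}_{q,d}$ is the subset of those of total degree $d$. $X_q:=\{x_i\colon 0\le i\le q-2\}$ and $\overline{X}_q:=\{x_{ij}\colon 0\le i,j\le q-2\}$ are sets of variables; all indices in the ideals range over $\{0,\ldots,q-2\}$, and an empty product is $1$. Put $F(x):=x^{q-1}-1$ and, for $a,b,c\in\mathbb{F}_q$ with $a\ne b$ (with $0^0=1$), $F_{a,b}:=F(\sum_{i=0}^{q-2}(a^i-b^i)x_i)$, $G^{\mathrm{row}}_{a,b,c}:=F(\sum_{i,j=0}^{q-2}(a^i-b^i)c^jx_{ji})$, $G^{\mathrm{col}}_{a,b,c}:=F(\sum_{i,j=0}^{q-2}(a^i-b^i)c^jx_{ij})$. Then $$\mathcal{I}_q:=\langle F_{a,b}\colon a,b\in\mathbb{F}_q,\ a\neq b\rangle+\langle x_i^q-x_i\colon 0\le i\le q-2\rangle\subset\mathbb{F}_q[X_q],$$ $$\mathcal{J}_q:=\langle G^{\mathrm{row}}_{a,b,c},\,G^{\mathrm{col}}_{a,b,c}\colon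 a,b,c\in\mathbb{F}_q,\ a\neq b\rangle+\langle x_{ij}^q-x_{ij}\colon 0\le i,j\le q-2\rangle\subset\mathbb{F}_q[\overline{X}_q].$$ For an ideal $I$ of a polynomial ring over $\mathbb{F}_q$ in $n$ variables, $\mathcal{Z}(I)$ denotes the set of points of $\mathbb{F}_q^n$ at which all elements of $I$ vanish; $I$ is zero-dimensional if the quotient ring by $I$ is a finite-dimensional $\mathbb{F}_q$-vector space. *)

theory Defs
  imports
    "HOL-Algebra.Embedded_Algebras"
    "HOL-Computational_Algebra.Polynomial"
    "HOL-Library.Poly_Mapping"
    "HOL-Library.FuncSet"
    "HOL-Library.Cardinality"
begin

section \<open>Polynomial rings in several variables, ideals and algebraic sets\<close>

text \<open>
  Polynomials with coefficients in \<open>'a\<close> and variables indexed by \<open>'x\<close> are finitely supported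
  functions from exponent vectors to coefficients; the product is the convolution product of
  \<^theory>\<open>HOL-Library.Poly_Mapping\<close>. The ring in the variables indexed by a set \<open>V\<close>
  is cut out as a carrier, so that its quotients are taken in the right ring.
\<close>

type_synonym ('x, 'a) mpoly = "('x \<Rightarrow>\<^sub>0 nat) \<Rightarrow>\<^sub>0 'a"

definition MVar :: "'x \<Rightarrow> ('x, 'a::comm_ring_1) mpoly" where
  "MVar i = Poly_Mapping.single (Poly_Mapping.single i 1) 1"

definition MConst :: "'a::comm_ring_1 \<Rightarrow> ('x, 'a) mpoly" where
  "MConst c = Poly_Mapping.single 0 c"

definition mpoly_ring :: "'x set \<Rightarrow> ('x, 'a::comm_ring_1) mpoly ring" where
  "mpoly_ring V =
     \<lparr> carrier = {p. \<forall>m \<in> Poly_Mapping.keys p. Poly_Mapping.keys m \<subseteq> V},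
       monoid.mult = (\<lambda>p r. p * r), one = 1, zero = 0, add = (\<lambda>p r. p + r) \<rparr>"

definition mpoly_eval :: "('x \<Rightarrow> 'a) \<Rightarrow> ('x, 'a::comm_ring_1) mpoly \<Rightarrow> 'a" where
  "mpoly_eval s p = (\<Sum>m \<in> Poly_Mapping.keys p.
     Poly_Mapping.lookup p m * (\<Prod>i \<in> Poly_Mapping.keys m. s i ^ Poly_Mapping.lookup m i))"

text \<open>Points of the affine space with coordinates indexed by \<open>V\<close> are extensional functions on \<open>V\<close>.\<close>

definition zero_set :: "'x set \<Rightarrow> ('x, 'a::comm_ring_1) mpoly set \<Rightarrow> ('x \<Rightarrow> 'a) set" where
  "zero_set V I = {s \<in> V \<rightarrow>\<^sub>E UNIV. \<forall>p \<in> I. mpoly_eval s p = 0}"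

text \<open>
  The copy of the coefficient field in the quotient by \<open>I\<close>. If \<open>I\<close> is the unit ideal, this copy
  collapses and is not a field, but the zero ring then still has dimension 0 over it in the sense
  of \<^const>\<open>ring.dim\<close>.
\<close>

definition quot_scalars :: "'x set \<Rightarrow> ('x, 'a::field) mpoly set \<Rightarrow> ('x, 'a) mpoly set set" where
  "quot_scalars V I = range (\<lambda>c. I +>\<^bsub>mpoly_ring V\<^esub> MConst c)"

definition zero_dimensional :: "'x set \<Rightarrow> ('x, 'a::field) mpoly set \<Rightarrow> bool" where
  "zero_dimensional V I \<longleftrightarrow>
     ideal I (mpoly_ring V) \<and>
     ring.finite_dimension (mpoly_ring V Quot I) (quot_scalars V I) (carrier (mpoly_ring V Quot I))"

definition quot_dim :: "'x set \<Rightarrow> ('x, 'a::field) mpoly set \<Rightarrow> nat" where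
  "quot_dim V I =
     ring.dim (mpoly_ring V Quot I) (quot_scalars V I) (carrier (mpoly_ring V Quot I))"

text \<open>The unit ideal counts as a radical ideal.\<close>

definition radical_of :: "('r, 'm) ring_scheme \<Rightarrow> 'r set \<Rightarrow> 'r set" where
  "radical_of R I = {r \<in> carrier R. \<exists>n::nat. n > 0 \<and> r [^]\<^bsub>R\<^esub> n \<in> I}"

definition radical_ideal :: "('r, 'm) ring_scheme \<Rightarrow> 'r set \<Rightarrow> bool" where
  "radical_ideal R I \<longleftrightarrow> ideal I R \<and> radical_of R I = I"


section \<open>Permutation polynomials and local permutation polynomials\<close>

text \<open>Throughout, \<open>'a\<close> is the finite field and \<open>CARD('a)\<close> is its order \<open>q\<close>.\<close>

definition perm_polys :: "'a::{finite,field} poly set" where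
  "perm_polys = {f. Polynomial.degree f < CARD('a) \<and> bij (poly f)}"

definition perm_polys_deg :: "nat \<Rightarrow> 'a::{finite,field} poly set" where
  "perm_polys_deg d = {f \<in> perm_polys. Polynomial.degree f = d}"

text \<open>
  An element of \<open>'a poly poly\<close> is a polynomial in \<open>x\<close> and \<open>y\<close> with \<open>y\<close> as the outer variable:
  the coefficient of \<open>x^i * y^j\<close> in \<open>f\<close> is \<open>bicoeff f i j\<close>.
\<close>

definition bicoeff :: "'a::zero poly poly \<Rightarrow> nat \<Rightarrow> nat \<Rightarrow> 'a" where
  "bicoeff f i j = Polynomial.coeff (Polynomial.coeff f j) i"

definition bieval :: "'a::comm_ring_1 poly poly \<Rightarrow> 'a \<Rightarrow> 'a \<Rightarrow> 'a" where
  "bieval f x y = poly (poly f [:y:]) x"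

text \<open>The total degree of the zero polynomial is 0 by convention.\<close>

definition total_deg :: "'a::zero poly poly \<Rightarrow> nat" where
  "total_deg f = Max (insert 0 {i + j | i j. bicoeff f i j \<noteq> 0})"

definition local_perm_polys :: "'a::{finite,field} poly poly set" where
  "local_perm_polys =
     {f. (\<forall>i j. bicoeff f i j \<noteq> 0 \<longrightarrow> i < CARD('a) \<and> j < CARD('a)) \<and>
         (\<forall>a. bij (\<lambda>x. bieval f x a) \<and> bij (\<lambda>y. bieval f a y))}"

definition local_perm_polys_deg :: "nat \<Rightarrow> 'a::{finite,field} poly poly set" where
  "local_perm_polys_deg d = {f \<in> local_perm_polys. total_deg f = d}"


section \<open>The ideals\<close>

text \<open>The index sets \<open>{0, \<dots>, q - 2}\<close> and its square; the argument only carries the field.\<close>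

definition idx :: "'a::{finite,field} itself \<Rightarrow> nat set" where
  "idx _ = {0..CARD('a) - 2}"

definition idx2 :: "'a::{finite,field} itself \<Rightarrow> (nat \<times> nat) set" where
  "idx2 F = idx F \<times> idx F"

definition FF :: "('x, 'a::{finite,field}) mpoly \<Rightarrow> ('x, 'a) mpoly" where
  "FF p = p ^ (CARD('a) - 1) - 1"

definition F_gen :: "'a::{finite,field} \<Rightarrow> 'a \<Rightarrow> (nat, 'a) mpoly" where
  "F_gen a b = FF (\<Sum>i \<in> idx TYPE('a). MConst (a ^ i - b ^ i) * MVar i)"

definition G_row :: "'a::{finite,field} \<Rightarrow> 'a \<Rightarrow> 'a \<Rightarrow> (nat \<times> nat, 'a) mpoly" where
  "G_row a b c = FF (\<Sum>i \<in> idx TYPE('a). \<Sum>j \<in> idx TYPE('a).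
     MConst ((a ^ i - b ^ i) * c ^ j) * MVar (j, i))"

definition G_col :: "'a::{finite,field} \<Rightarrow> 'a \<Rightarrow> 'a \<Rightarrow> (nat \<times> nat, 'a) mpoly" where
  "G_col a b c = FF (\<Sum>i \<in> idx TYPE('a). \<Sum>j \<in> idx TYPE('a).
     MConst ((a ^ i - b ^ i) * c ^ j) * MVar (i, j))"

definition I_ring :: "(nat, 'a::{finite,field}) mpoly ring" where
  "I_ring = mpoly_ring (idx TYPE('a))"

definition J_ring :: "(nat \<times> nat, 'a::{finite,field}) mpoly ring" where
  "J_ring = mpoly_ring (idx2 TYPE('a))"

definition I_ideal :: "(nat, 'a::{finite,field}) mpoly set" where
  "I_ideal =
     Idl\<^bsub>I_ring\<^esub> {F_gen a b | a b. a \<noteq> b} <+>\<^bsub>I_ring\<^esub>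
     Idl\<^bsub>I_ring\<^esub> {MVar i ^ CARD('a) - MVar i | i. i \<in> idx TYPE('a)}"

definition J_ideal :: "(nat \<times> nat, 'a::{finite,field}) mpoly set" where
  "J_ideal =
     Idl\<^bsub>J_ring\<^esub> ({G_row a b c | a b c. a \<noteq> b} \<union> {G_col a b c | a b c. a \<noteq> b}) <+>\<^bsub>J_ring\<^esub>
     Idl\<^bsub>J_ring\<^esub> {MVar v ^ CARD('a) - MVar v | v. v \<in> idx2 TYPE('a)}"

definition I_ideal_deg :: "nat \<Rightarrow> (nat, 'a::{finite,field}) mpoly set" where
  "I_ideal_deg d =
     I_ideal <+>\<^bsub>I_ring\<^esub>
     Idl\<^bsub>I_ring\<^esub> {MVar i | i. i \<in> idx TYPE('a) \<and> i > d} <+>\<^bsub>I_ring\<^esub>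
     Idl\<^bsub>I_ring\<^esub> {MVar d ^ (CARD('a) - 1) - 1}"

definition J_ideal_deg :: "nat \<Rightarrow> (nat \<times> nat, 'a::{finite,field}) mpoly set" where
  "J_ideal_deg d =
     J_ideal <+>\<^bsub>J_ring\<^esub>
     Idl\<^bsub>J_ring\<^esub> {MVar (i, j) | i j. (i, j) \<in> idx2 TYPE('a) \<and> i + j > d} <+>\<^bsub>J_ring\<^esub>
     Idl\<^bsub>J_ring\<^esub> {\<Prod>(i, j) \<in> {(i, j) \<in> idx2 TYPE('a). i + j = d}.
                     (MVar (i, j) ^ (CARD('a) - 1) - 1)}"


section \<open>From points to polynomials\<close>

definition point_poly :: "(nat \<Rightarrow> 'a::{finite,field}) \<Rightarrow> 'a poly" where
  "point_poly s = (\<Sum>i \<in> idx TYPE('a). Polynomial.monom (s i) i)"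

definition point_bipoly :: "(nat \<times> nat \<Rightarrow> 'a::{finite,field}) \<Rightarrow> 'a poly poly" where
  "point_bipoly s = (\<Sum>i \<in> idx TYPE('a). \<Sum>j \<in> idx TYPE('a).
     Polynomial.monom (Polynomial.monom (s (i, j)) i) j)"

end

theory Submission
  imports Defs
begin

text \<open>
  On a point set \<open>F\<^sup>n\<close> the products \<open>e\<^sub>s = \<Prod>\<^sub>i \<delta>(x\<^sub>i, s\<^sub>i)\<close> of one-variable delta functions sum to 1,
  and \<open>p e\<^sub>s \<equiv> p(s) e\<^sub>s\<close> modulo the polynomials \<open>x\<^sub>i\<^sup>q - x\<^sub>i\<close>. Hence an ideal \<open>I\<close> containing all
  \<open>x\<^sub>i\<^sup>q - x\<^sub>i\<close> contains \<open>e\<^sub>s\<close> for every \<open>s\<close> outside its zero set, so it consists of all polynomials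
  that vanish on its zero set: it is radical, and the classes of the \<open>e\<^sub>s\<close> with \<open>s\<close> in the zero set
  are a basis of the quotient.

  A generator \<open>F(l)\<close> vanishes at a point iff the linear form \<open>l\<close> does not, so the zero sets express
  injectivity of the polynomial functions. That every permutation polynomial is reached comes from the
  power sums \<open>\<Sum>\<^sub>a a\<^sup>k\<close>, which vanish for \<open>k < q - 1\<close> but not for \<open>k = q - 1\<close>: the
  coefficient of \<open>x\<^sup>q\<^sup>-\<^sup>1\<close> is minus the sum of all values, hence 0.
\<close>

section \<open>The ring of polynomials in several variables\<close>

lemma mpoly_ring_simps [simp]:
  "x \<oplus>\<^bsub>mpoly_ring V\<^esub> y = x + y"
  "x \<otimes>\<^bsub>mpoly_ring V\<^esub> y = x * y"
  "\<zero>\<^bsub>mpoly_ring V\<^esub> = 0"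
  "\<one>\<^bsub>mpoly_ring V\<^esub> = 1"
  by (simp_all add: mpoly_ring_def)

lemma mpoly_carrier_iff:
  "p \<in> carrier (mpoly_ring V) \<longleftrightarrow> (\<forall>m \<in> Poly_Mapping.keys p. Poly_Mapping.keys m \<subseteq> V)"
  by (simp add: mpoly_ring_def)

lemma mpoly_carrier_zero [simp]: "0 \<in> carrier (mpoly_ring V)"
  by (simp add: mpoly_carrier_iff)

lemma mpoly_carrier_MConst [simp]: "MConst c \<in> carrier (mpoly_ring V)"
  by (simp add: mpoly_carrier_iff MConst_def)

lemma mpoly_carrier_one [simp]: "1 \<in> carrier (mpoly_ring V)"
  by (simp add: mpoly_carrier_iff)

lemma mpoly_carrier_MVar [simp]: "i \<in> V \<Longrightarrow> MVar i \<in> carrier (mpoly_ring V)"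
  by (simp add: mpoly_carrier_iff MVar_def)

lemma mpoly_carrier_add [simp]:
  "p \<in> carrier (mpoly_ring V) \<Longrightarrow> r \<in> carrier (mpoly_ring V) \<Longrightarrow> p + r \<in> carrier (mpoly_ring V)"
  using keys_add[of p r] by (auto simp: mpoly_carrier_iff)

lemma keys_add_nat: "Poly_Mapping.keys (m + n :: 'x \<Rightarrow>\<^sub>0 nat) = Poly_Mapping.keys m \<union> Poly_Mapping.keys n"
  by (auto simp: in_keys_iff lookup_add)

lemma mpoly_carrier_mult [simp]:
  "p \<in> carrier (mpoly_ring V) \<Longrightarrow> r \<in> carrier (mpoly_ring V) \<Longrightarrow> p * r \<in> carrier (mpoly_ring V)"
  using keys_mult[of p r] by (force simp: mpoly_carrier_iff keys_add_nat)

lemma mpoly_carrier_uminus [simp]: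
  "p \<in> carrier (mpoly_ring V) \<Longrightarrow> - p \<in> carrier (mpoly_ring V)"
  by (auto simp: mpoly_carrier_iff in_keys_iff)

lemma mpoly_carrier_diff [simp]:
  "p \<in> carrier (mpoly_ring V) \<Longrightarrow> r \<in> carrier (mpoly_ring V) \<Longrightarrow> p - r \<in> carrier (mpoly_ring V)"
  using mpoly_carrier_add[of p V "- r"] by simp

lemma mpoly_carrier_power [simp]:
  "p \<in> carrier (mpoly_ring V) \<Longrightarrow> p ^ n \<in> carrier (mpoly_ring V)"
  by (induction n) auto

lemma mpoly_carrier_sum:
  "(\<And>i. i \<in> A \<Longrightarrow> f i \<in> carrier (mpoly_ring V)) \<Longrightarrow> sum f A \<in> carrier (mpoly_ring V)"
  by (induction A rule: infinite_finite_induct) auto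

lemma mpoly_carrier_prod:
  "(\<And>i. i \<in> A \<Longrightarrow> f i \<in> carrier (mpoly_ring V)) \<Longrightarrow> prod f A \<in> carrier (mpoly_ring V)"
  by (induction A rule: infinite_finite_induct) auto

lemma cring_mpoly_ring: "cring (mpoly_ring V)"
proof (rule cringI)
  show "abelian_group (mpoly_ring V)"
  proof (rule abelian_groupI)
    fix p assume "p \<in> carrier (mpoly_ring V)"
    then show "\<exists>r\<in>carrier (mpoly_ring V). r \<oplus>\<^bsub>mpoly_ring V\<^esub> p = \<zero>\<^bsub>mpoly_ring V\<^esub>"
      by (intro bexI[of _ "- p"]) auto
  qed (auto simp: algebra_simps)
  show "Group.comm_monoid (mpoly_ring V)"
    by (rule comm_monoidI) (auto simp: algebra_simps)
qed (auto simp: algebra_simps)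

lemma ring_mpoly_ring: "ring (mpoly_ring V)"
  by (rule cring.axioms(1)) (rule cring_mpoly_ring)

lemma mpoly_ring_nat_pow [simp]: "p [^]\<^bsub>mpoly_ring V\<^esub> (n::nat) = p ^ n"
  by (induction n) (simp_all add: nat_pow_def mult.commute)

lemma mpoly_ring_a_inv [simp]:
  "p \<in> carrier (mpoly_ring V) \<Longrightarrow> \<ominus>\<^bsub>mpoly_ring V\<^esub> p = - p"
  by (rule abelian_group.minus_equality[OF ring.is_abelian_group[OF ring_mpoly_ring]]) auto

section \<open>Constants, variables and the monomial expansion\<close>

lemma MConst_0 [simp]: "MConst 0 = 0"
  and MConst_1 [simp]: "MConst 1 = 1"
  and MConst_add: "MConst (a + b) = MConst a + MConst b"
  and MConst_uminus: "MConst (- a) = - MConst a"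
  and MConst_mult: "MConst (a * b) = MConst a * MConst b"
  by (simp_all add: MConst_def single_add single_uminus mult_single)

lemma MConst_power: "MConst (a ^ n) = MConst a ^ n"
  by (induction n) (simp_all add: MConst_mult)

lemma MConst_sum: "MConst (sum f A) = (\<Sum>i\<in>A. MConst (f i))"
  by (induction A rule: infinite_finite_induct) (simp_all add: MConst_add)

lemma poly_mapping_eq_sum_single:
  "p = (\<Sum>k\<in>Poly_Mapping.keys p. Poly_Mapping.single k (Poly_Mapping.lookup p k))"
  by (rule poly_mapping_eqI)
     (auto simp: lookup_sum lookup_single when_def in_keys_iff sum.delta)

lemma MVar_power: "MVar i ^ n = Poly_Mapping.single (Poly_Mapping.single i n) 1"
  by (induction n) (simp_all add: MVar_def mult_single single_add[symmetric])

lemma single_eq_prod_MVar: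
  fixes m :: "'x \<Rightarrow>\<^sub>0 nat"
  shows "(Poly_Mapping.single m 1 :: ('x, 'a::comm_ring_1) mpoly) = (\<Prod>i\<in>Poly_Mapping.keys m. MVar i ^ Poly_Mapping.lookup m i)"
proof -
  have "(\<Prod>i\<in>A. MVar i ^ Poly_Mapping.lookup m i) =
        (Poly_Mapping.single (\<Sum>i\<in>A. Poly_Mapping.single i (Poly_Mapping.lookup m i)) 1 :: ('x, 'a) mpoly)" for A
    by (induction A rule: infinite_finite_induct) (simp_all add: MVar_power mult_single)
  from this[of "Poly_Mapping.keys m"] show ?thesis
    by (simp only: poly_mapping_eq_sum_single[of m, symmetric])
qed

text \<open>Serves as an induction principle: a set of polynomials closed under sums and products
  contains every polynomial whose constants and variables it contains.\<close>

lemma mpoly_expansion: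
  "p = (\<Sum>m\<in>Poly_Mapping.keys p. MConst (Poly_Mapping.lookup p m) *
          (\<Prod>i\<in>Poly_Mapping.keys m. MVar i ^ Poly_Mapping.lookup m i))"
proof -
  have "p = (\<Sum>m\<in>Poly_Mapping.keys p. MConst (Poly_Mapping.lookup p m) * Poly_Mapping.single m 1)"
    unfolding MConst_def mult_single using poly_mapping_eq_sum_single[of p] by simp
  then show ?thesis
    by (simp only: single_eq_prod_MVar)
qed


section \<open>Evaluation\<close>

lemma mpoly_eval_add [simp]: "mpoly_eval s (p + r) = mpoly_eval s p + mpoly_eval s r"
  unfolding mpoly_eval_def
  \<comment> \<open>Cancellation can make the support of \<open>p + r\<close> smaller than the union
    of the supports; this does no harm because the summand is additive in the coefficient and 0 at
    coefficient 0.\<close>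
  by (rule setsum_keys_plus_distrib[where
        f = "\<lambda>m c. c * (\<Prod>i\<in>Poly_Mapping.keys m. s i ^ Poly_Mapping.lookup m i)"])
     (simp_all add: algebra_simps)

lemma mpoly_eval_zero [simp]: "mpoly_eval s 0 = 0"
  by (simp add: mpoly_eval_def)

lemma mpoly_eval_single:
  "mpoly_eval s (Poly_Mapping.single m c) =
     c * (\<Prod>i\<in>Poly_Mapping.keys m. s i ^ Poly_Mapping.lookup m i)"
  by (simp add: mpoly_eval_def)

lemma mpoly_eval_MConst [simp]: "mpoly_eval s (MConst c) = c"
  by (simp add: MConst_def mpoly_eval_single)

lemma mpoly_eval_one [simp]: "mpoly_eval s 1 = 1"
  using mpoly_eval_MConst[of s 1] by simp

lemma mpoly_eval_MVar [simp]: "mpoly_eval s (MVar i) = s i"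
  by (simp add: MVar_def mpoly_eval_single)

lemma mpoly_eval_sum [simp]: "mpoly_eval s (sum f A) = (\<Sum>i\<in>A. mpoly_eval s (f i))"
  by (induction A rule: infinite_finite_induct) simp_all

lemma mpoly_eval_uminus [simp]: "mpoly_eval s (- p) = - mpoly_eval s p"
  using mpoly_eval_add[of s p "- p"] by (simp add: eq_neg_iff_add_eq_0 add.commute)

lemma mpoly_eval_diff [simp]: "mpoly_eval s (p - r) = mpoly_eval s p - mpoly_eval s r"
  using mpoly_eval_add[of s p "- r"] by simp

lemma mpoly_eval_mult_single:
  "mpoly_eval s (Poly_Mapping.single m a * Poly_Mapping.single n b) =
     mpoly_eval s (Poly_Mapping.single m a) * mpoly_eval s (Poly_Mapping.single n b)"
proof -
  let ?P = "\<lambda>A m. \<Prod>i\<in>A. s i ^ Poly_Mapping.lookup m i"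
  let ?U = "Poly_Mapping.keys m \<union> Poly_Mapping.keys n"
  \<comment> \<open>Both monomials are evaluated over a common support; the added indices contribute
    factors \<open>s i ^ 0 = 1\<close>.\<close>
  have "?P ?U k = ?P (Poly_Mapping.keys k) k" if "Poly_Mapping.keys k \<subseteq> ?U" for k
    using that by (intro prod.mono_neutral_right) (auto simp: in_keys_iff)
  from this[of m] this[of n] show ?thesis
    by (simp add: mult_single mpoly_eval_single keys_add_nat lookup_add power_add prod.distrib mult_ac)
qed

lemma mpoly_eval_mult [simp]: "mpoly_eval s (p * r) = mpoly_eval s p * mpoly_eval s r"
proof -
  have "mpoly_eval s ((\<Sum>m\<in>Poly_Mapping.keys p. Poly_Mapping.single m (Poly_Mapping.lookup p m)) *
                      (\<Sum>n\<in>Poly_Mapping.keys r. Poly_Mapping.single n (Poly_Mapping.lookup r n))) =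
        mpoly_eval s (\<Sum>m\<in>Poly_Mapping.keys p. Poly_Mapping.single m (Poly_Mapping.lookup p m)) *
        mpoly_eval s (\<Sum>n\<in>Poly_Mapping.keys r. Poly_Mapping.single n (Poly_Mapping.lookup r n))"
    by (simp add: sum_product mpoly_eval_mult_single)
  then show ?thesis
    by (simp flip: poly_mapping_eq_sum_single)
qed

lemma mpoly_eval_power [simp]: "mpoly_eval s (p ^ n) = mpoly_eval s p ^ n"
  by (induction n) simp_all

lemma mpoly_eval_prod [simp]: "mpoly_eval s (prod f A) = (\<Prod>i\<in>A. mpoly_eval s (f i))"
  by (induction A rule: infinite_finite_induct) simp_all


section \<open>Power sums over a finite field\<close>

lemma CARD_field_gt_1: "CARD('a::{finite,field}) > 1"
proof -
  have "card {0, 1 :: 'a} \<le> CARD('a)"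
    by (rule card_mono) auto
  then show ?thesis
    by simp
qed

text \<open>Multiplication by \<open>c\<close> permutes the nonzero elements, so their product,
  which is nonzero, is unchanged by the factor \<open>c ^ (q - 1)\<close>.\<close>

lemma finite_field_power_card_minus_1:
  fixes c :: "'a::{finite,field}"
  assumes "c \<noteq> 0"
  shows "c ^ (CARD('a) - 1) = 1"
proof -
  have "(\<Prod>y\<in>UNIV - {0}. c * y) = \<Prod>(UNIV - {0})"
    by (rule prod.reindex_bij_witness[of _ "\<lambda>y. y / c" "\<lambda>y. c * y"]) (use assms in auto)
  then have "c ^ card (UNIV - {0 :: 'a}) * \<Prod>(UNIV - {0}) = \<Prod>(UNIV - {0})"
    by (simp only: prod.distrib prod_constant)
  moreover have "\<Prod>(UNIV - {0 :: 'a}) \<noteq> 0"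
    by (subst prod_zero_iff) auto
  ultimately show ?thesis
    by simp
qed

lemma finite_field_power_card:
  fixes c :: "'a::{finite,field}"
  shows "c ^ CARD('a) = c"
proof (cases "c = 0")
  case False
  then show ?thesis
    using finite_field_power_card_minus_1[OF False] by (subst power_eq_if) auto
qed auto

text \<open>The translation by 1 permutes the field, so it leaves the sum of all elements unchanged
  while adding q to it.\<close>

lemma of_nat_card_finite_field: "of_nat CARD('a) = (0 :: 'a::{finite,field})"
proof -
  have "(\<Sum>a\<in>(UNIV :: 'a set). a + 1) = (\<Sum>a\<in>UNIV. a)"
    by (rule sum.reindex_bij_witness[of _ "\<lambda>y. y - 1" "\<lambda>y. y + 1"]) auto
  then show ?thesis
    by (simp add: sum.distrib)
qed

text \<open>For k > 0 the polynomial x^k - 1 has at most k < q - 1 roots, so some nonzero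
  \<open>c\<close> has \<open>c ^ k \<noteq> 1\<close>. Substituting \<open>c * a\<close> for
  \<open>a\<close> multiplies the sum by \<open>c ^ k\<close> without changing it. For k = 0 the sum
  is q, with 0^0 = 1.\<close>

lemma power_sum_finite_field_eq_0:
  assumes "k < CARD('a) - 1"
  shows "(\<Sum>a\<in>(UNIV :: 'a::{finite,field} set). a ^ k) = 0"
proof (cases "k = 0")
  case True
  then show ?thesis
    by (simp add: of_nat_card_finite_field)
next
  case False
  obtain c :: 'a where c: "c \<noteq> 0" "c ^ k \<noteq> 1"
  proof (rule ccontr)
    assume *: "\<not> thesis"
    define p :: "'a poly" where "p = Polynomial.monom 1 k - 1"
    have deg: "Polynomial.degree p = k"
      using False unfolding p_def diff_conv_add_uminus
      by (subst degree_add_eq_left) (auto simp: Polynomial.degree_monom_eq)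
    then have "p \<noteq> 0"
      using False by auto
    have "UNIV - {0} \<subseteq> {x. poly p x = 0}"
      using * that by (auto simp: p_def Polynomial.poly_monom)
    then have "card (UNIV - {0 :: 'a}) \<le> card {x. poly p x = 0}"
      by (intro card_mono) auto
    also have "\<dots> \<le> k"
      using card_poly_roots_bound[OF \<open>p \<noteq> 0\<close>] deg by simp
    finally show False
      using assms by simp
  qed
  have "(\<Sum>a\<in>(UNIV :: 'a set). (c * a) ^ k) = (\<Sum>a\<in>UNIV. a ^ k)"
    by (rule sum.reindex_bij_witness[of _ "\<lambda>y. y / c" "\<lambda>y. c * y"]) (use c in auto)
  then have "c ^ k * (\<Sum>a\<in>(UNIV :: 'a set). a ^ k) = (\<Sum>a\<in>UNIV. a ^ k)"
    by (simp only: power_mult_distrib sum_distrib_left)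
  then show ?thesis
    using c by simp
qed

text \<open>Each nonzero element contributes 1 and zero contributes 0, so the sum is q - 1, which is
  -1 in the field.\<close>

lemma power_sum_finite_field_card_minus_1:
  "(\<Sum>a\<in>(UNIV :: 'a::{finite,field} set). a ^ (CARD('a) - 1)) = - 1"
proof -
  have "(\<Sum>a\<in>(UNIV :: 'a set). a ^ (CARD('a) - 1)) = (\<Sum>a\<in>(UNIV :: 'a set). 1 - (if a = 0 then 1 else 0))"
    by (intro sum.cong refl) (use CARD_field_gt_1[where 'a = 'a] finite_field_power_card_minus_1 in auto)
  then show ?thesis
    by (simp add: sum_subtractf of_nat_card_finite_field)
qed


section \<open>Ideals containing the field equations\<close>

text \<open>
  The sum is \<open>(x\<^sup>q - a\<^sup>q) / (x - a)\<close>, which the Frobenius identity would turn into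
  \<open>(x - a)\<^sup>q\<^sup>-\<^sup>1\<close>; the expanded form makes that identity unnecessary.
\<close>

definition delta_poly :: "'a::{finite,field} \<Rightarrow> ('x, 'a) mpoly \<Rightarrow> ('x, 'a) mpoly" where
  "delta_poly a x = 1 - (\<Sum>k<CARD('a). MConst (a ^ (CARD('a) - Suc k)) * x ^ k)"

text \<open>Because a^q = a, the polynomial x^q - a is a difference of q-th powers and splits off x
  - a. Modulo the field equation of x, this lets x be replaced by a next to its delta
  function.\<close>

lemma delta_poly_annihilated:
  fixes a :: "'a::{finite,field}"
  shows "(x - MConst a) * delta_poly a x = x - x ^ CARD('a)"
proof -
  have "x ^ CARD('a) - MConst a = x ^ CARD('a) - MConst a ^ CARD('a)"
    by (simp add: finite_field_power_card flip: MConst_power)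
  also have "\<dots> = (x - MConst a) * (\<Sum>k<CARD('a). MConst (a ^ (CARD('a) - Suc k)) * x ^ k)"
    by (simp add: power_diff_sumr2 MConst_power)
  finally show ?thesis
    by (simp add: delta_poly_def algebra_simps)
qed

text \<open>After swapping the sums, the coefficient of x^k is the power sum of exponent q - 1 - k,
  which survives only for k = 0, with value -1. The q ones in front add up to 0, so 0 - (-1)
  remains.\<close>

lemma sum_delta_poly:
  "(\<Sum>a\<in>(UNIV :: 'a::{finite,field} set). delta_poly a x) = 1"
proof -
  let ?q = "CARD('a)"
  have "(\<Sum>a\<in>(UNIV :: 'a set). \<Sum>k<?q. MConst (a ^ (?q - Suc k)) * x ^ k) =
        (\<Sum>k<?q. MConst (\<Sum>a\<in>(UNIV :: 'a set). a ^ (?q - Suc k)) * x ^ k)"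
    by (subst sum.swap) (simp add: MConst_sum sum_distrib_right)
  also have "\<dots> = (\<Sum>k<?q. if k = 0 then - 1 else 0)"
    by (intro sum.cong refl)
       (use power_sum_finite_field_card_minus_1[where 'a = 'a] in
         \<open>auto simp: power_sum_finite_field_eq_0 MConst_uminus\<close>)
  also have "\<dots> = - 1"
    using CARD_field_gt_1[where 'a = 'a] by simp
  finally have "(\<Sum>a\<in>(UNIV :: 'a set). \<Sum>k<?q. MConst (a ^ (?q - Suc k)) * x ^ k) = - 1" .
  moreover have "(\<Sum>a\<in>(UNIV :: 'a set). 1) = (0 :: ('x, 'a) mpoly)"
    using of_nat_card_finite_field[where 'a = 'a]
    by (simp add: of_nat_single)
  ultimately show ?thesis
    by (simp add: delta_poly_def sum_subtractf)
qed

lemma mpoly_carrier_delta_poly [simp]: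
  "x \<in> carrier (mpoly_ring V) \<Longrightarrow> delta_poly a x \<in> carrier (mpoly_ring V)"
  unfolding delta_poly_def by (intro mpoly_carrier_diff mpoly_carrier_sum) auto

text \<open>Values in the field satisfy x^q = x, so the annihilation identity forces 0 unless the
  value is \<open>a\<close>. As the delta functions sum to 1, the single remaining one must be
  1.\<close>

lemma mpoly_eval_delta_poly:
  "mpoly_eval s (delta_poly a x) = (if mpoly_eval s x = a then 1 else 0)"
proof -
  have 0: "mpoly_eval s (delta_poly b x) = 0" if "mpoly_eval s x \<noteq> b" for b
  proof -
    have "(mpoly_eval s x - b) * mpoly_eval s (delta_poly b x) = 0"
      using arg_cong[OF delta_poly_annihilated[of x b], of "mpoly_eval s"]
      by (simp add: finite_field_power_card)
    then show ?thesis
      using that by simp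
  qed
  have "1 = (\<Sum>b\<in>UNIV. mpoly_eval s (delta_poly b x))"
    using arg_cong[OF sum_delta_poly[of x], of "mpoly_eval s"] by simp
  also have "\<dots> = (\<Sum>b\<in>UNIV. if b = mpoly_eval s x then mpoly_eval s (delta_poly b x) else 0)"
    by (intro sum.cong) (auto simp: 0)
  also have "\<dots> = mpoly_eval s (delta_poly (mpoly_eval s x) x)"
    by simp
  finally show ?thesis
    using 0 by auto
qed

text \<open>These are the polynomials \<open>e\<^sub>s\<close> of the overview.\<close>

definition point_delta :: "'x set \<Rightarrow> ('x \<Rightarrow> 'a) \<Rightarrow> ('x, 'a::{finite,field}) mpoly" where
  "point_delta V s = (\<Prod>i\<in>V. delta_poly (s i) (MVar i))"

lemma mpoly_carrier_point_delta [simp]: "point_delta V s \<in> carrier (mpoly_ring V)"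
  unfolding point_delta_def by (intro mpoly_carrier_prod) auto

text \<open>Abstracts what the two ideals of the theorem share. The whole ring is an admissible
  \<open>I\<close>, so the zero set may be empty.\<close>

locale field_equations_ideal = ideal I "mpoly_ring V"
  for V :: "'x set" and I :: "('x, 'a::{finite,field}) mpoly set" +
  assumes finite_V: "finite V"
    and field_equations: "i \<in> V \<Longrightarrow> MVar i ^ CARD('a) - MVar i \<in> I"
begin

section \<open>Closure properties, and point deltas modulo the ideal\<close>

lemma add_mem: "p \<in> I \<Longrightarrow> r \<in> I \<Longrightarrow> p + r \<in> I"
  using additive_subgroup.a_closed[OF is_additive_subgroup, of p r] by simp

lemma zero_mem: "0 \<in> I"
  using additive_subgroup.zero_closed[OF is_additive_subgroup] by simp

lemma mult_mem: "p \<in> I \<Longrightarrow> r \<in> carrier (mpoly_ring V) \<Longrightarrow> r * p \<in> I"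
  using I_l_closed[of p r] by simp

lemma uminus_mem: "p \<in> I \<Longrightarrow> - p \<in> I"
  using mult_mem[of p "- 1"] by simp

lemma sum_mem: "(\<And>i. i \<in> A \<Longrightarrow> f i \<in> I) \<Longrightarrow> sum f A \<in> I"
  by (induction A rule: infinite_finite_induct) (auto intro: add_mem zero_mem)

text \<open>Expand the product over the variables of the sums of their delta functions; every such
  sum is 1.\<close>

lemma sum_point_delta: "(\<Sum>s\<in>V \<rightarrow>\<^sub>E UNIV. point_delta V s) = 1"
  unfolding point_delta_def
  by (subst prod_sum_PiE[symmetric]) (auto simp: finite_V sum_delta_poly)

text \<open>The factor of \<open>point_delta\<close> belonging to \<open>i\<close> turns the product
  into a multiple of the field equation of \<open>i\<close>.\<close>

lemma MVar_point_delta_mem: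
  assumes "i \<in> V"
  shows "(MVar i - MConst (s i)) * point_delta V s \<in> I"
proof -
  let ?r = "\<Prod>j\<in>V - {i}. delta_poly (s j) (MVar j)"
  have "(MVar i - MConst (s i)) * point_delta V s =
        (MVar i - MConst (s i)) * delta_poly (s i) (MVar i) * ?r"
    unfolding point_delta_def using assms finite_V by (subst prod.remove[of _ i]) (auto simp: mult_ac)
  also have "\<dots> = - ?r * (MVar i ^ CARD('a) - MVar i)"
    by (subst delta_poly_annihilated) (simp add: algebra_simps)
  also have "\<dots> \<in> I"
    using assms by (intro mult_mem field_equations mpoly_carrier_uminus mpoly_carrier_prod) auto
  finally show ?thesis .
qed

text \<open>The polynomials with this property form a set closed under sums and products that
  contains the constants and the variables in \<open>V\<close>; by the monomial expansion it is the
  whole ring.\<close>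

lemma mult_point_delta_mem:
  assumes p: "p \<in> carrier (mpoly_ring V)"
  shows "(p - MConst (mpoly_eval s p)) * point_delta V s \<in> I"
proof -
  let ?e = "point_delta V s"
  define A where "A = {p \<in> carrier (mpoly_ring V). (p - MConst (mpoly_eval s p)) * ?e \<in> I}"
  have const: "MConst c \<in> A" for c
    by (simp add: A_def zero_mem)
  have add: "p + r \<in> A" if "p \<in> A" "r \<in> A" for p r
  proof -
    have "(p + r - MConst (mpoly_eval s (p + r))) * ?e =
      (p - MConst (mpoly_eval s p)) * ?e + (r - MConst (mpoly_eval s r)) * ?e"
      by (simp add: MConst_add algebra_simps)
    also have "\<dots> \<in> I"
      using that by (intro add_mem) (auto simp: A_def)
    finally show ?thesis
      using that by (simp add: A_def)
  qed
  have mult: "p * r \<in> A" if "p \<in> A" "r \<in> A" for p r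
  proof -
    \<comment> \<open>Product rule for differences: pr - p(s)r(s) = r(p - p(s)) + p(s)(r -
      r(s)).\<close>
    have "(p * r - MConst (mpoly_eval s (p * r))) * ?e =
      r * ((p - MConst (mpoly_eval s p)) * ?e) +
      MConst (mpoly_eval s p) * ((r - MConst (mpoly_eval s r)) * ?e)"
      by (simp add: MConst_mult algebra_simps)
    also have "\<dots> \<in> I"
      using that by (intro add_mem[OF mult_mem mult_mem]) (auto simp: A_def)
    finally show ?thesis
      using that by (simp add: A_def)
  qed
  have var: "MVar i \<in> A" if "i \<in> V" for i
    using that by (simp add: A_def MVar_point_delta_mem)
  have power: "p ^ n \<in> A" if "p \<in> A" for p n
    using that mult const[of 1] by (induction n) auto
  have prod: "prod f B \<in> A" if "\<And>i. i \<in> B \<Longrightarrow> f i \<in> A" for f :: "'x \<Rightarrow> ('x, 'a) mpoly" and B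
    using that mult const[of 1] by (induction B rule: infinite_finite_induct) auto
  have sum: "sum f B \<in> A" if "\<And>i. i \<in> B \<Longrightarrow> f i \<in> A" for f :: "('x \<Rightarrow>\<^sub>0 nat) \<Rightarrow> ('x, 'a) mpoly" and B
    using that add const[of 0] by (induction B rule: infinite_finite_induct) auto
  have "p \<in> A"
    using p by (subst mpoly_expansion) (auto simp: mpoly_carrier_iff intro!: sum mult const prod power var)
  then show ?thesis
    by (simp add: A_def)
qed

lemma mpoly_eval_point_delta:
  assumes "s \<in> V \<rightarrow>\<^sub>E UNIV" "t \<in> V \<rightarrow>\<^sub>E UNIV"
  shows "mpoly_eval t (point_delta V s) = (if s = t then 1 else 0)"
proof (cases "s = t")
  case False
  then obtain i where "i \<in> V" "t i \<noteq> s i"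
    using assms by (metis PiE_ext)
  then show ?thesis
    using False finite_V unfolding point_delta_def mpoly_eval_prod
    by (auto simp: mpoly_eval_delta_poly intro!: bexI[of _ i])
qed (simp add: point_delta_def mpoly_eval_delta_poly)

text \<open>Some \<open>g\<close> in the ideal has a nonzero value at \<open>s\<close>. Since g e_s
  is congruent to g(s) e_s, the latter lies in the ideal, and the constant g(s) can be divided
  out.\<close>

lemma point_delta_mem:
  assumes "s \<in> V \<rightarrow>\<^sub>E UNIV" "s \<notin> zero_set V I"
  shows "point_delta V s \<in> I"
proof -
  obtain g where g: "g \<in> I" "mpoly_eval s g \<noteq> 0"
    using assms by (auto simp: zero_set_def)
  have "- ((g - MConst (mpoly_eval s g)) * point_delta V s) + point_delta V s * g \<in> I"
    using g a_subset by (intro add_mem uminus_mem mult_mem mult_point_delta_mem) auto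
  then have "MConst (mpoly_eval s g) * point_delta V s \<in> I"
    by (simp add: algebra_simps)
  then have "MConst (inverse (mpoly_eval s g)) * (MConst (mpoly_eval s g) * point_delta V s) \<in> I"
    by (rule mult_mem) simp
  moreover have "MConst (inverse (mpoly_eval s g)) * MConst (mpoly_eval s g) = (1 :: ('x, 'a) mpoly)"
    using g by (simp flip: MConst_mult)
  ultimately show ?thesis
    by (simp flip: mult.assoc)
qed

text \<open>Nullstellensatz over the finite field. Write p as the sum of all p e_s: for s in the
  zero set, p e_s is congruent to p(s) e_s = 0; for the other s, e_s itself is in the ideal.\<close>

lemma mem_iff_vanishing:
  assumes p: "p \<in> carrier (mpoly_ring V)"
  shows "p \<in> I \<longleftrightarrow> (\<forall>s\<in>zero_set V I. mpoly_eval s p = 0)"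
proof
  assume vanish: "\<forall>s\<in>zero_set V I. mpoly_eval s p = 0"
  have "p * point_delta V s \<in> I" if s: "s \<in> V \<rightarrow>\<^sub>E UNIV" for s
  proof (cases "s \<in> zero_set V I")
    case True
    then show ?thesis
      using vanish mult_point_delta_mem[OF p, of s] by simp
  next
    case False
    then show ?thesis
      by (intro mult_mem point_delta_mem p s)
  qed
  then have "(\<Sum>s\<in>V \<rightarrow>\<^sub>E UNIV. p * point_delta V s) \<in> I"
    by (rule sum_mem)
  then show "p \<in> I"
    by (simp add: sum_distrib_left[symmetric] sum_point_delta)
qed (auto simp: zero_set_def)

lemma finite_zero_set: "finite (zero_set V I)"
  by (rule finite_subset[of _ "V \<rightarrow>\<^sub>E UNIV"]) (auto simp: zero_set_def intro: finite_PiE finite_V)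

lemma radical: "radical_ideal (mpoly_ring V) I"
proof -
  have "p \<in> I" if "p \<in> carrier (mpoly_ring V)" "n > 0" "p ^ n \<in> I" for p and n :: nat
    using that by (auto simp: mem_iff_vanishing)
  moreover have "\<exists>n>0. p ^ n \<in> I" if "p \<in> I" for p
    using that by (intro exI[of _ 1]) auto
  ultimately show ?thesis
    using a_subset is_ideal by (auto simp: radical_ideal_def radical_of_def)
qed

lemma coset_eq_iff:
  assumes "p \<in> carrier (mpoly_ring V)" "r \<in> carrier (mpoly_ring V)"
  shows "I +>\<^bsub>mpoly_ring V\<^esub> p = I +>\<^bsub>mpoly_ring V\<^esub> r \<longleftrightarrow>
         (\<forall>s\<in>zero_set V I. mpoly_eval s p = mpoly_eval s r)"
proof -
  have "I +>\<^bsub>mpoly_ring V\<^esub> p = I +>\<^bsub>mpoly_ring V\<^esub> r \<longleftrightarrow> p - r \<in> I"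
    using assms quotient_eq_iff_same_a_r_cos[OF is_ideal, of p r] by (simp add: a_minus_def)
  then show ?thesis
    using assms by (simp add: mem_iff_vanishing)
qed


section \<open>Dimension of the quotient over the coefficient field\<close>

lemma carrier_Quot: "carrier (mpoly_ring V Quot I) = (\<lambda>p. I +>\<^bsub>mpoly_ring V\<^esub> p) ` carrier (mpoly_ring V)"
  by (auto simp: FactRing_def A_RCOSETS_def')

lemma zero_Quot: "\<zero>\<^bsub>mpoly_ring V Quot I\<^esub> = I +>\<^bsub>mpoly_ring V\<^esub> 0"
  using a_rcos_const[OF zero_mem] by (simp add: FactRing_def)

text \<open>Viewing classes as functions on the zero set, these are the functions supported in
  \<open>S\<close>. Adding the points of \<open>S\<close> one by one builds the quotient from the
  zero space, one dimension at a time.\<close>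

definition supported_classes :: "('x \<Rightarrow> 'a) set \<Rightarrow> ('x, 'a) mpoly set set" where
  "supported_classes S = (\<lambda>p. I +>\<^bsub>mpoly_ring V\<^esub> p) `
     {p \<in> carrier (mpoly_ring V). \<forall>s\<in>zero_set V I - S. mpoly_eval s p = 0}"

text \<open>Membership can be tested on any representative, because congruent polynomials agree on
  the zero set.\<close>

lemma mem_supported_classes_iff:
  assumes "p \<in> carrier (mpoly_ring V)"
  shows "I +>\<^bsub>mpoly_ring V\<^esub> p \<in> supported_classes S \<longleftrightarrow>
         (\<forall>s\<in>zero_set V I - S. mpoly_eval s p = 0)"
proof
  assume "I +>\<^bsub>mpoly_ring V\<^esub> p \<in> supported_classes S"
  then obtain r where "r \<in> carrier (mpoly_ring V)" "\<forall>s\<in>zero_set V I - S. mpoly_eval s r = 0"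
      "I +>\<^bsub>mpoly_ring V\<^esub> p = I +>\<^bsub>mpoly_ring V\<^esub> r"
    unfolding supported_classes_def by auto
  then show "\<forall>s\<in>zero_set V I - S. mpoly_eval s p = 0"
    using assms by (simp add: coset_eq_iff)
qed (use assms in \<open>auto simp: supported_classes_def\<close>)

text \<open>Moves the line extension from cosets to representatives, so that it can be compared with
  \<open>supported_classes\<close> by evaluating polynomials.\<close>

lemma line_extension_Quot:
  assumes e: "e \<in> carrier (mpoly_ring V)"
  shows "ring.line_extension (mpoly_ring V Quot I) (quot_scalars V I)
           (I +>\<^bsub>mpoly_ring V\<^esub> e) (supported_classes S) =
         {I +>\<^bsub>mpoly_ring V\<^esub> (MConst c * e + p) |c p. p \<in> carrier (mpoly_ring V) \<and>
            (\<forall>s\<in>zero_set V I - S. mpoly_eval s p = 0)}"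
proof -
  have "(I +>\<^bsub>mpoly_ring V\<^esub> MConst c) \<otimes>\<^bsub>mpoly_ring V Quot I\<^esub> (I +>\<^bsub>mpoly_ring V\<^esub> e)
          \<oplus>\<^bsub>mpoly_ring V Quot I\<^esub> (I +>\<^bsub>mpoly_ring V\<^esub> p) = I +>\<^bsub>mpoly_ring V\<^esub> (MConst c * e + p)"
    if "p \<in> carrier (mpoly_ring V)" for c p
    using e that by (simp add: FactRing_def rcoset_mult_add a_rcos_sum)
  moreover have "ring.line_extension (mpoly_ring V Quot I) (quot_scalars V I)
           (I +>\<^bsub>mpoly_ring V\<^esub> e) (supported_classes S) =
      {(I +>\<^bsub>mpoly_ring V\<^esub> MConst c) \<otimes>\<^bsub>mpoly_ring V Quot I\<^esub> (I +>\<^bsub>mpoly_ring V\<^esub> e)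
          \<oplus>\<^bsub>mpoly_ring V Quot I\<^esub> (I +>\<^bsub>mpoly_ring V\<^esub> p) |c p. p \<in> carrier (mpoly_ring V) \<and>
            (\<forall>s\<in>zero_set V I - S. mpoly_eval s p = 0)}"
    unfolding ring.line_extension_def[OF quotient_is_ring] set_add_def' r_coset_def
      quot_scalars_def supported_classes_def by blast
  ultimately show ?thesis
    by (auto; blast)
qed

text \<open>Subtracting p(t) e_t from p removes its value at \<open>t\<close> and changes no value
  at the other points of the zero set.\<close>

lemma supported_classes_insert:
  assumes t: "t \<in> zero_set V I" "t \<notin> S"
  shows "supported_classes (insert t S) =
         ring.line_extension (mpoly_ring V Quot I) (quot_scalars V I)
           (I +>\<^bsub>mpoly_ring V\<^esub> point_delta V t) (supported_classes S)"
proof -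
  let ?e = "point_delta V t"
  have e: "mpoly_eval s ?e = (if t = s then 1 else 0)" if "s \<in> zero_set V I" for s
    using t that by (intro mpoly_eval_point_delta) (auto simp: zero_set_def)
  have "I +>\<^bsub>mpoly_ring V\<^esub> p \<in> ring.line_extension (mpoly_ring V Quot I) (quot_scalars V I)
           (I +>\<^bsub>mpoly_ring V\<^esub> ?e) (supported_classes S)"
    if p: "p \<in> carrier (mpoly_ring V)" "\<forall>s\<in>zero_set V I - insert t S. mpoly_eval s p = 0" for p
  proof -
    let ?c = "MConst (mpoly_eval t p)"
    have "I +>\<^bsub>mpoly_ring V\<^esub> p = I +>\<^bsub>mpoly_ring V\<^esub> (?c * ?e + (p - ?c * ?e))"
      by simp
    moreover have "p - ?c * ?e \<in> carrier (mpoly_ring V)"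
      using p by simp
    moreover have "\<forall>s\<in>zero_set V I - S. mpoly_eval s (p - ?c * ?e) = 0"
      using p by (auto simp: e)
    ultimately show ?thesis
      unfolding line_extension_Quot[OF mpoly_carrier_point_delta] by blast
  qed
  then have "supported_classes (insert t S) \<subseteq>
      ring.line_extension (mpoly_ring V Quot I) (quot_scalars V I)
        (I +>\<^bsub>mpoly_ring V\<^esub> ?e) (supported_classes S)"
    unfolding supported_classes_def[of "insert t S"] by blast
  moreover have "I +>\<^bsub>mpoly_ring V\<^esub> (MConst c * ?e + p) \<in> supported_classes (insert t S)"
    if "p \<in> carrier (mpoly_ring V)" "\<forall>s\<in>zero_set V I - S. mpoly_eval s p = 0" for c p
    using that by (auto simp: mem_supported_classes_iff e)
  ultimately show ?thesis
    unfolding line_extension_Quot[OF mpoly_carrier_point_delta] by blast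
qed

text \<open>Each new point \<open>t\<close> adds the class of its point delta, which is new because
  its value at \<open>t\<close> is 1 while classes supported in \<open>S\<close> vanish
  there.\<close>

lemma dimension_supported_classes:
  assumes "S \<subseteq> zero_set V I"
  shows "ring.dimension (mpoly_ring V Quot I) (card S) (quot_scalars V I) (supported_classes S)"
proof -
  interpret Q: ring "mpoly_ring V Quot I"
    by (rule quotient_is_ring)
  have "finite S"
    using assms finite_zero_set by (rule finite_subset)
  then show ?thesis
    using assms
  proof (induction S rule: finite_induct)
    case empty
    have "X = I +>\<^bsub>mpoly_ring V\<^esub> 0" if X: "X \<in> supported_classes {}" for X
    proof -
      obtain p where "X = I +>\<^bsub>mpoly_ring V\<^esub> p" "p \<in> carrier (mpoly_ring V)"
          "\<forall>s\<in>zero_set V I. mpoly_eval s p = 0"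
        using X unfolding supported_classes_def by auto
      then show ?thesis
        by (simp add: coset_eq_iff)
    qed
    moreover have "I +>\<^bsub>mpoly_ring V\<^esub> 0 \<in> supported_classes {}"
      by (simp add: mem_supported_classes_iff)
    ultimately have "supported_classes {} = {I +>\<^bsub>mpoly_ring V\<^esub> 0}"
      by blast
    then show ?case
      using Q.zero_dim[of "quot_scalars V I"] by (simp add: zero_Quot)
  next
    case (insert t S)
    let ?e = "I +>\<^bsub>mpoly_ring V\<^esub> point_delta V t"
    have t: "t \<in> zero_set V I"
      using insert by simp
    then have "mpoly_eval t (point_delta V t) = 1"
      by (subst mpoly_eval_point_delta) (auto simp: zero_set_def)
    then have "?e \<notin> supported_classes S"
      using insert t by (auto simp: mem_supported_classes_iff intro!: bexI[of _ t])
    moreover have "?e \<in> carrier (mpoly_ring V Quot I)"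
      by (simp add: carrier_Quot)
    ultimately have "Q.dimension (Suc (card S)) (quot_scalars V I)
        (Q.line_extension (quot_scalars V I) ?e (supported_classes S))"
      using insert by (intro Q.Suc_dim) auto
    then show ?case
      using insert by (simp add: supported_classes_insert)
  qed
qed

lemma dimension_Quot:
  "ring.dimension (mpoly_ring V Quot I) (card (zero_set V I)) (quot_scalars V I)
     (carrier (mpoly_ring V Quot I))"
  using dimension_supported_classes[of "zero_set V I"]
  by (simp add: supported_classes_def carrier_Quot)

lemma zero_dimensional: "zero_dimensional V I"
  using dimension_Quot is_ideal ring.finite_dimensionI[OF quotient_is_ring]
  by (simp add: zero_dimensional_def)

text \<open>Uniqueness of the dimension requires the scalars to form a field; this is shown for the
  constants here and carried to the quotient next.\<close>

lemma subfield_MConst: "subfield (range MConst) (mpoly_ring V :: ('x, 'a) mpoly ring)"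
proof (rule subfieldI)
  show "subcring (range MConst) (mpoly_ring V :: ('x, 'a) mpoly ring)"
    by (intro subcringI subringI)
       (auto simp flip: MConst_uminus MConst_mult MConst_add MConst_1 simp: mult.commute)
  have "MConst c \<in> Units (mpoly_ring V\<lparr>carrier := range MConst\<rparr>) \<longleftrightarrow> c \<noteq> 0" for c :: 'a
  proof
    assume "MConst c \<in> Units (mpoly_ring V\<lparr>carrier := range MConst\<rparr>)"
    then show "c \<noteq> 0"
      by (auto simp: Units_def)
  next
    assume "c \<noteq> 0"
    then have "MConst c * MConst (inverse c) = (1 :: ('x, 'a) mpoly)"
      by (simp flip: MConst_mult)
    then show "MConst c \<in> Units (mpoly_ring V\<lparr>carrier := range MConst\<rparr>)"
      by (auto simp: Units_def mult.commute intro!: exI[of _ "inverse c"])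
  qed
  moreover have "MConst c = (0 :: ('x, 'a) mpoly) \<longleftrightarrow> c = 0" for c :: 'a
    by (metis mpoly_eval_MConst mpoly_eval_zero MConst_0)
  ultimately show "Units (mpoly_ring V\<lparr>carrier := range MConst\<rparr>) =
      range MConst - {\<zero>\<^bsub>mpoly_ring V :: ('x, 'a) mpoly ring\<^esub>}"
    by (auto simp: Units_def)
qed

text \<open>Evaluation at a point of the zero set separates 1 from 0, so the quotient is not the
  zero ring and the image of the constants remains a field.\<close>

lemma subfield_quot_scalars:
  assumes "zero_set V I \<noteq> {}"
  shows "subfield (quot_scalars V I) (mpoly_ring V Quot I)"
proof -
  interpret h: ring_hom_ring "mpoly_ring V" "mpoly_ring V Quot I" "(+>\<^bsub>mpoly_ring V\<^esub>) I"
    by (rule rcos_ring_hom_ring)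
  have "I +>\<^bsub>mpoly_ring V\<^esub> 1 \<noteq> I +>\<^bsub>mpoly_ring V\<^esub> 0"
    using assms by (auto simp: coset_eq_iff)
  then have "\<one>\<^bsub>mpoly_ring V Quot I\<^esub> \<noteq> \<zero>\<^bsub>mpoly_ring V Quot I\<^esub>"
    unfolding zero_Quot by (simp add: FactRing_def)
  then show ?thesis
    using h.img_is_subfield(2)[OF subfield_MConst] by (simp add: quot_scalars_def image_image)
qed

text \<open>
  For the unit ideal the scalars do not form a field, so uniqueness of the dimension
  has to be checked by hand.
\<close>

lemma quot_dim_eq: "quot_dim V I = card (zero_set V I)"
proof -
  interpret Q: ring "mpoly_ring V Quot I"
    by (rule quotient_is_ring)
  show ?thesis
  proof (cases "zero_set V I = {}")
    case False
    then show ?thesis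
      using Q.dimI[OF subfield_quot_scalars dimension_Quot] by (simp add: quot_dim_def over_def)
  next
    case True
    then have trivial: "carrier (mpoly_ring V Quot I) \<subseteq> {\<zero>\<^bsub>mpoly_ring V Quot I\<^esub>}"
      unfolding carrier_Quot zero_Quot using True by (simp add: image_subset_iff coset_eq_iff)
    \<comment> \<open>A step raising the dimension would need a vector outside \<open>E\<close>, but
      the only vector is zero and already lies in \<open>E\<close>.\<close>
    have 0: "n = 0 \<and> E = {\<zero>\<^bsub>mpoly_ring V Quot I\<^esub>}" if "Q.dimension n K E" for n K E
      using that
    proof (induction rule: Q.dimension.induct)
      case (Suc_dim v E n K)
      then have "v = \<zero>\<^bsub>mpoly_ring V Quot I\<^esub>"
        using trivial by blast
      then show ?case
        using Suc_dim by blast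
    qed simp
    have "Q.dim (quot_scalars V I) (carrier (mpoly_ring V Quot I)) = 0"
      unfolding Q.dim_def
    proof (rule the_equality)
      show "Q.dimension 0 (quot_scalars V I) (carrier (mpoly_ring V Quot I))"
        using dimension_Quot True by simp
    qed (use 0 in blast)
    then show ?thesis
      using True by (simp add: quot_dim_def)
  qed
qed

end


section \<open>Zero sets\<close>

text \<open>The polynomials vanishing at a fixed point form an ideal, so they contain the ideal
  generated by \<open>S\<close> as soon as they contain \<open>S\<close>.\<close>

lemma zero_set_genideal:
  assumes "S \<subseteq> carrier (mpoly_ring V)"
  shows "zero_set V (Idl\<^bsub>mpoly_ring V\<^esub> S) = zero_set V S"
proof -
  interpret cring "mpoly_ring V"
    by (rule cring_mpoly_ring)
  have "mpoly_eval s p = 0" if "\<forall>p\<in>S. mpoly_eval s p = 0" "p \<in> Idl\<^bsub>mpoly_ring V\<^esub> S" for s p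
  proof -
    have "subgroup {p \<in> carrier (mpoly_ring V). mpoly_eval s p = 0} (add_monoid (mpoly_ring V))"
      by (rule add.subgroupI) (auto intro: exI[of _ 0])
    then have "ideal {p \<in> carrier (mpoly_ring V). mpoly_eval s p = 0} (mpoly_ring V)"
      by (rule idealI[OF ring_axioms]) auto
    then have "Idl\<^bsub>mpoly_ring V\<^esub> S \<subseteq> {p \<in> carrier (mpoly_ring V). mpoly_eval s p = 0}"
      by (rule genideal_minimal) (use assms that in auto)
    then show ?thesis
      using that by blast
  qed
  then show ?thesis
    using genideal_self[OF assms] by (auto simp: zero_set_def)
qed

lemma ideal_zero_mem: "ideal I (mpoly_ring V) \<Longrightarrow> 0 \<in> I"
  using additive_subgroup.zero_closed[OF ideal.axioms(1), of I "mpoly_ring V"] by simp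

lemma set_add_supersets:
  assumes "ideal I (mpoly_ring V)" "ideal J (mpoly_ring V)"
  shows "I \<subseteq> I <+>\<^bsub>mpoly_ring V\<^esub> J" "J \<subseteq> I <+>\<^bsub>mpoly_ring V\<^esub> J"
proof -
  have "p + 0 \<in> I <+>\<^bsub>mpoly_ring V\<^esub> J" if "p \<in> I" for p
    using that ideal_zero_mem[OF assms(2)] by (force simp: set_add_def')
  then show "I \<subseteq> I <+>\<^bsub>mpoly_ring V\<^esub> J"
    by auto
  have "0 + p \<in> I <+>\<^bsub>mpoly_ring V\<^esub> J" if "p \<in> J" for p
    using that ideal_zero_mem[OF assms(1)] by (force simp: set_add_def')
  then show "J \<subseteq> I <+>\<^bsub>mpoly_ring V\<^esub> J"
    by auto
qed

lemma zero_set_add: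
  assumes "ideal I (mpoly_ring V)" "ideal J (mpoly_ring V)"
  shows "zero_set V (I <+>\<^bsub>mpoly_ring V\<^esub> J) = zero_set V I \<inter> zero_set V J"
proof -
  have "mpoly_eval s p = 0"
    if "\<forall>p\<in>I. mpoly_eval s p = 0" "\<forall>p\<in>J. mpoly_eval s p = 0" "p \<in> I <+>\<^bsub>mpoly_ring V\<^esub> J" for s p
    using that by (auto simp: set_add_def')
  then show ?thesis
    using set_add_supersets[OF assms] by (auto simp: zero_set_def)
qed

lemma ideal_genideal_mpoly:
  "S \<subseteq> carrier (mpoly_ring V) \<Longrightarrow> ideal (Idl\<^bsub>mpoly_ring V\<^esub> S) (mpoly_ring V)"
  by (rule ring.genideal_ideal[OF ring_mpoly_ring])

lemma genideal_self_mpoly: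
  "S \<subseteq> carrier (mpoly_ring V) \<Longrightarrow> S \<subseteq> Idl\<^bsub>mpoly_ring V\<^esub> S"
  by (rule ring.genideal_self[OF ring_mpoly_ring])

lemma ideal_add_mpoly:
  "ideal I (mpoly_ring V) \<Longrightarrow> ideal J (mpoly_ring V) \<Longrightarrow> ideal (I <+>\<^bsub>mpoly_ring V\<^esub> J) (mpoly_ring V)"
  by (rule ring.add_ideals[OF ring_mpoly_ring])

text \<open>The common shape of both ideals: \<open>S1\<close> encodes the permutation property,
  \<open>S2\<close> the field equations, \<open>S3\<close> kills the coefficients above degree d,
  and \<open>S4\<close> forces degree d to occur. \<open>S2\<close> leaves no trace in the zero set
  because every point satisfies x^q = x.\<close>

lemma
  fixes V :: "'x set" and S1 S2 S3 S4 :: "('x, 'a::{finite,field}) mpoly set"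
  assumes V: "finite V"
    and S: "S1 \<subseteq> carrier (mpoly_ring V)" "S3 \<subseteq> carrier (mpoly_ring V)" "S4 \<subseteq> carrier (mpoly_ring V)"
    and S2: "S2 = {MVar v ^ CARD('a) - MVar v |v. v \<in> V}"
    and I: "I = Idl\<^bsub>mpoly_ring V\<^esub> S1 <+>\<^bsub>mpoly_ring V\<^esub> Idl\<^bsub>mpoly_ring V\<^esub> S2
      <+>\<^bsub>mpoly_ring V\<^esub> Idl\<^bsub>mpoly_ring V\<^esub> S3 <+>\<^bsub>mpoly_ring V\<^esub> Idl\<^bsub>mpoly_ring V\<^esub> S4"
  shows field_equations_ideal_sum: "field_equations_ideal V I"
    and zero_set_sum: "zero_set V I =
      {s \<in> V \<rightarrow>\<^sub>E UNIV. \<forall>p\<in>S1 \<union> S3 \<union> S4. mpoly_eval s p = 0}"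
proof -
  have S2': "S2 \<subseteq> carrier (mpoly_ring V)"
    by (auto simp: S2)
  note ideals = ideal_genideal_mpoly[OF S(1)] ideal_genideal_mpoly[OF S2']
    ideal_genideal_mpoly[OF S(2)] ideal_genideal_mpoly[OF S(3)]
  note sums = ideal_add_mpoly[OF ideals(1,2)] ideal_add_mpoly[OF ideal_add_mpoly[OF ideals(1,2)] ideals(3)]
  have "S2 \<subseteq> I"
    unfolding I using genideal_self_mpoly[OF S2'] set_add_supersets(2)[OF ideals(1,2)]
      set_add_supersets(1)[OF sums(1) ideals(3)] set_add_supersets(1)[OF sums(2) ideals(4)] by blast
  moreover have "ideal I (mpoly_ring V)"
    unfolding I by (rule ideal_add_mpoly[OF sums(2) ideals(4)])
  ultimately show "field_equations_ideal V I"
    using V by (auto simp: field_equations_ideal_def field_equations_ideal_axioms_def S2)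
  have "zero_set V I = zero_set V S1 \<inter> zero_set V S2 \<inter> zero_set V S3 \<inter> zero_set V S4"
    unfolding I using S S2' by (simp add: zero_set_add zero_set_genideal ideals sums)
  moreover have "zero_set V S2 = V \<rightarrow>\<^sub>E UNIV"
    by (auto simp: zero_set_def S2 finite_field_power_card)
  ultimately show "zero_set V I = {s \<in> V \<rightarrow>\<^sub>E UNIV. \<forall>p\<in>S1 \<union> S3 \<union> S4. mpoly_eval s p = 0}"
    by (auto simp: zero_set_def)
qed

section \<open>Zeros of the generators \<open>FF\<close>, and bijections of a finite set\<close>

lemma mpoly_carrier_FF: "p \<in> carrier (mpoly_ring V) \<Longrightarrow> FF p \<in> carrier (mpoly_ring V)"
  by (simp add: FF_def)

lemma power_card_minus_1_eq_1_iff: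
  "(c :: 'a::{finite,field}) ^ (CARD('a) - 1) = 1 \<longleftrightarrow> c \<noteq> 0"
  using CARD_field_gt_1[where 'a = 'a] finite_field_power_card_minus_1[of c] by (cases "c = 0") (auto simp: power_0_left)

lemma mpoly_eval_FF_eq_0_iff: "mpoly_eval s (FF p) = 0 \<longleftrightarrow> mpoly_eval s p \<noteq> 0"
  using power_card_minus_1_eq_1_iff[of "mpoly_eval s p"] by (simp add: FF_def)

lemma finite_idx [simp]: "finite (idx T)"
  by (simp add: idx_def)

lemma finite_idx2 [simp]: "finite (idx2 T)"
  by (simp add: idx2_def)

lemma bij_iff_finite:
  fixes f :: "'a::finite \<Rightarrow> 'a"
  shows "bij f \<longleftrightarrow> (\<forall>a b. a \<noteq> b \<longrightarrow> f a \<noteq> f b)"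
  using finite_UNIV_inj_surj[of f] by (auto simp: bij_def inj_def)


section \<open>Permutation polynomials have degree at most \<open>q - 2\<close>\<close>

lemma poly_eq_sum_lessThan:
  fixes p :: "'a::comm_semiring_1 poly"
  assumes "Polynomial.degree p < n"
  shows "poly p x = (\<Sum>k<n. Polynomial.coeff p k * x ^ k)"
  unfolding poly_altdef using assms
  by (intro sum.mono_neutral_left) (auto simp: coeff_eq_0)

lemma coeff_eq_0_if_bij:
  fixes p :: "'a::{finite,field} poly"
  assumes "CARD('a) > 2" "Polynomial.degree p < CARD('a)" "bij (poly p)"
  shows "Polynomial.coeff p (CARD('a) - 1) = 0"
proof -
  let ?q = "CARD('a)"
  have "(\<Sum>a\<in>UNIV. poly p a) = (\<Sum>a\<in>UNIV. a)"
    using assms(3) by (rule sum.reindex_bij_betw)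
  \<comment> \<open>The exponent 1 is below q - 1 because q > 2; for q = 2 the polynomial x violates
    the claim.\<close>
  also have "\<dots> = 0"
    using power_sum_finite_field_eq_0[of 1, where 'a = 'a] assms(1) by simp
  finally have "0 = (\<Sum>a\<in>UNIV. \<Sum>k<?q. Polynomial.coeff p k * a ^ k)"
    by (simp add: poly_eq_sum_lessThan[OF assms(2)])
  also have "\<dots> = (\<Sum>k<?q. Polynomial.coeff p k * (\<Sum>a\<in>UNIV. a ^ k))"
    by (subst sum.swap) (simp add: sum_distrib_left)
  also have "\<dots> = (\<Sum>k<?q. if k = ?q - 1 then - Polynomial.coeff p k else 0)"
  proof (intro sum.cong refl)
    fix k assume "k \<in> {..<?q}"
    then consider "k < ?q - 1" | "k = ?q - 1"
      by fastforce
    then show "Polynomial.coeff p k * (\<Sum>a\<in>UNIV. a ^ k) =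
        (if k = ?q - 1 then - Polynomial.coeff p k else 0)"
      by cases (auto simp: power_sum_finite_field_eq_0 power_sum_finite_field_card_minus_1[simplified])
  qed
  also have "\<dots> = - Polynomial.coeff p (?q - 1)"
    using assms(1) by simp
  finally show ?thesis
    by simp
qed

lemma poly_eq_0_if_vanishing:
  fixes p :: "'a::{finite,field} poly"
  assumes "Polynomial.degree p < CARD('a)" "\<And>a. poly p a = 0"
  shows "p = 0"
  using assms card_poly_roots_bound[of p] by fastforce


section \<open>Univariate polynomials\<close>

lemma coeff_point_poly:
  "Polynomial.coeff (point_poly s) i = (if i \<in> idx TYPE('a) then s i else (0 :: 'a::{finite,field}))"
  by (simp add: point_poly_def coeff_sum)

lemma poly_point_poly: "poly (point_poly s) a = (\<Sum>i\<in>idx TYPE('a). s i * a ^ i)"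
  for a :: "'a::{finite,field}"
  by (simp add: point_poly_def poly_sum Polynomial.poly_monom)

lemma mpoly_eval_F_gen:
  "mpoly_eval s (F_gen a b) = 0 \<longleftrightarrow> poly (point_poly s) a \<noteq> poly (point_poly s) b"
  by (simp add: F_gen_def mpoly_eval_FF_eq_0_iff poly_point_poly right_diff_distrib sum_subtractf mult.commute)

lemma
  fixes d :: nat
  assumes "d \<in> idx TYPE('a::{finite,field})"
  shows field_equations_I_ideal_deg:
      "field_equations_ideal (idx TYPE('a)) (I_ideal_deg d :: (nat, 'a) mpoly set)"
    and zero_set_I_ideal_deg: "zero_set (idx TYPE('a)) (I_ideal_deg d :: (nat, 'a) mpoly set) =
      {s \<in> idx TYPE('a) \<rightarrow>\<^sub>E UNIV. bij (poly (point_poly s)) \<and>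
         (\<forall>i\<in>idx TYPE('a). i > d \<longrightarrow> s i = 0) \<and> s d \<noteq> 0}"
proof -
  let ?V = "idx TYPE('a)"
  let ?S1 = "{F_gen a b |a b :: 'a. a \<noteq> b}" and ?S3 = "{MVar i |i. i \<in> ?V \<and> i > d} :: (nat, 'a) mpoly set"
    and ?S4 = "{MVar d ^ (CARD('a) - 1) - 1} :: (nat, 'a) mpoly set"
  \<comment> \<open>The bound on \<open>d\<close> enters here: it makes the variable with index
    \<open>d\<close> an element of the ring.\<close>
  have *: "?S1 \<subseteq> carrier (mpoly_ring ?V)" "?S3 \<subseteq> carrier (mpoly_ring ?V)" "?S4 \<subseteq> carrier (mpoly_ring ?V)"
    using assms by (auto simp: F_gen_def intro!: mpoly_carrier_FF mpoly_carrier_sum)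
  show "field_equations_ideal ?V (I_ideal_deg d :: (nat, 'a) mpoly set)"
    by (rule field_equations_ideal_sum[OF finite_idx * refl])
       (simp add: I_ideal_deg_def I_ideal_def I_ring_def)
  have "zero_set ?V (I_ideal_deg d :: (nat, 'a) mpoly set) =
      {s \<in> ?V \<rightarrow>\<^sub>E UNIV. \<forall>p\<in>?S1 \<union> ?S3 \<union> ?S4. mpoly_eval s p = 0}"
    by (rule zero_set_sum[OF finite_idx * refl])
       (simp add: I_ideal_deg_def I_ideal_def I_ring_def)
  also have "\<dots> = {s \<in> ?V \<rightarrow>\<^sub>E UNIV. bij (poly (point_poly s)) \<and>
         (\<forall>i\<in>?V. i > d \<longrightarrow> s i = 0) \<and> s d \<noteq> 0}"
  proof -
    have "(\<forall>p\<in>?S1. mpoly_eval s p = 0) \<longleftrightarrow> bij (poly (point_poly s))" for s :: "nat \<Rightarrow> 'a"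
    proof -
      have "(\<forall>p\<in>?S1. mpoly_eval s p = 0) \<longleftrightarrow> (\<forall>a b. a \<noteq> b \<longrightarrow> mpoly_eval s (F_gen a b) = 0)"
        by blast
      then show ?thesis
        by (simp add: bij_iff_finite mpoly_eval_F_gen)
    qed
    moreover have "(\<forall>p\<in>?S3. mpoly_eval s p = 0) \<longleftrightarrow> (\<forall>i\<in>?V. i > d \<longrightarrow> s i = 0)" for s :: "nat \<Rightarrow> 'a"
      by auto
    moreover have "(\<forall>p\<in>?S4. mpoly_eval s p = 0) \<longleftrightarrow> s d \<noteq> 0" for s :: "nat \<Rightarrow> 'a"
      by (simp add: power_card_minus_1_eq_1_iff[simplified])
    ultimately show ?thesis
      by (simp only: ball_Un conj_assoc)
  qed
  finally show "zero_set ?V (I_ideal_deg d :: (nat, 'a) mpoly set) = \<dots>" .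
qed

text \<open>The inverse reads off coefficients, restricted to obtain an extensional point. Nothing
  is lost, since a polynomial of degree d <= q - 2 has all its coefficients at indices in
  \<open>idx\<close>.\<close>

lemma bij_betw_point_poly:
  assumes "d \<in> idx TYPE('a::{finite,field})"
  shows "bij_betw point_poly (zero_set (idx TYPE('a)) (I_ideal_deg d))
           (perm_polys_deg d :: 'a poly set)"
proof (rule bij_betw_byWitness[where f' = "\<lambda>f. restrict (Polynomial.coeff f) (idx TYPE('a))"])
  have d: "d < CARD('a)"
    using assms CARD_field_gt_1[where 'a = 'a] by (auto simp: idx_def)
  have inv: "point_poly (restrict (Polynomial.coeff f) (idx TYPE('a))) = f"
    if "Polynomial.degree f = d" for f :: "'a poly"
    using that assms by (intro poly_eqI) (auto simp: coeff_point_poly idx_def coeff_eq_0)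
  show "\<forall>s\<in>zero_set (idx TYPE('a)) (I_ideal_deg d).
      restrict (Polynomial.coeff (point_poly s)) (idx TYPE('a)) = (s :: nat \<Rightarrow> 'a)"
    by (auto simp: zero_set_I_ideal_deg[OF assms] coeff_point_poly fun_eq_iff PiE_def extensional_def)
  show "\<forall>f\<in>perm_polys_deg d. point_poly (restrict (Polynomial.coeff f) (idx TYPE('a))) = (f :: 'a poly)"
    by (simp add: perm_polys_deg_def inv)
  show "point_poly ` zero_set (idx TYPE('a)) (I_ideal_deg d) \<subseteq> (perm_polys_deg d :: 'a poly set)"
  proof safe
    fix s :: "nat \<Rightarrow> 'a" assume "s \<in> zero_set (idx TYPE('a)) (I_ideal_deg d)"
    then have s: "bij (poly (point_poly s))" "\<forall>i\<in>idx TYPE('a). i > d \<longrightarrow> s i = 0" "s d \<noteq> 0"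
      by (simp_all add: zero_set_I_ideal_deg[OF assms])
    have "Polynomial.degree (point_poly s) = d"
      using s assms by (intro antisym degree_le le_degree) (auto simp: coeff_point_poly)
    then show "point_poly s \<in> perm_polys_deg d"
      using s d by (simp add: perm_polys_deg_def perm_polys_def)
  qed
  show "(\<lambda>f. restrict (Polynomial.coeff f) (idx TYPE('a))) ` (perm_polys_deg d :: 'a poly set) \<subseteq>
      zero_set (idx TYPE('a)) (I_ideal_deg d)"
  proof safe
    fix f :: "'a poly" assume f: "f \<in> perm_polys_deg d"
    \<comment> \<open>The zero polynomial also has degree 0, so it must be excluded before the
      coefficient at \<open>d\<close> can be called nonzero.\<close>
    then have "f \<noteq> 0"
      by (auto simp: perm_polys_deg_def perm_polys_def bij_iff_finite) (metis zero_neq_one)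
    then have "Polynomial.coeff f d \<noteq> 0"
      using f by (auto simp: perm_polys_deg_def)
    then show "restrict (Polynomial.coeff f) (idx TYPE('a)) \<in> zero_set (idx TYPE('a)) (I_ideal_deg d)"
      using f assms by (auto simp: zero_set_I_ideal_deg inv perm_polys_deg_def perm_polys_def coeff_eq_0)
  qed
qed


section \<open>Bivariate polynomials\<close>

lemma bicoeff_point_bipoly:
  "bicoeff (point_bipoly s) i j = (if (i, j) \<in> idx2 TYPE('a) then s (i, j) else (0 :: 'a::{finite,field}))"
  by (cases "j \<in> idx TYPE('a)") (auto simp: bicoeff_def point_bipoly_def coeff_sum idx2_def)

lemma bieval_point_bipoly:
  "bieval (point_bipoly s) x y = (\<Sum>i\<in>idx TYPE('a). \<Sum>j\<in>idx TYPE('a). s (i, j) * x ^ i * y ^ j)"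
  for x :: "'a::{finite,field}"
  by (simp add: bieval_def point_bipoly_def poly_sum Polynomial.poly_monom poly_power)

lemma bipoly_eqI: "(\<And>i j. bicoeff f i j = bicoeff g i j) \<Longrightarrow> f = g"
  by (auto simp: bicoeff_def intro!: poly_eqI)

lemma mpoly_eval_G_col:
  "mpoly_eval s (G_col a b c) = 0 \<longleftrightarrow> bieval (point_bipoly s) a c \<noteq> bieval (point_bipoly s) b c"
  by (simp add: G_col_def mpoly_eval_FF_eq_0_iff bieval_point_bipoly left_diff_distrib
        right_diff_distrib sum_subtractf mult_ac)

lemma mpoly_eval_G_row:
  "mpoly_eval s (G_row a b c) = 0 \<longleftrightarrow> bieval (point_bipoly s) c a \<noteq> bieval (point_bipoly s) c b"
  unfolding bieval_point_bipoly
  \<comment> \<open>In \<open>G_row\<close> the outer index is the exponent of y, whereas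
    \<open>bieval_point_bipoly\<close> sums over the exponent of x first.\<close>
  by (subst (1 2) sum.swap)
     (simp add: G_row_def mpoly_eval_FF_eq_0_iff left_diff_distrib right_diff_distrib sum_subtractf mult_ac)

lemma
  shows field_equations_J_ideal_deg:
      "field_equations_ideal (idx2 TYPE('a)) (J_ideal_deg d :: (nat \<times> nat, 'a::{finite,field}) mpoly set)"
    and zero_set_J_ideal_deg: "zero_set (idx2 TYPE('a)) (J_ideal_deg d :: (nat \<times> nat, 'a) mpoly set) =
      {s \<in> idx2 TYPE('a) \<rightarrow>\<^sub>E UNIV.
         (\<forall>a. bij (\<lambda>x. bieval (point_bipoly s) x a) \<and> bij (\<lambda>y. bieval (point_bipoly s) a y)) \<and>
         (\<forall>i j. (i, j) \<in> idx2 TYPE('a) \<and> i + j > d \<longrightarrow> s (i, j) = 0) \<and>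
         (\<exists>i j. (i, j) \<in> idx2 TYPE('a) \<and> i + j = d \<and> s (i, j) \<noteq> 0)}"
proof -
  let ?V = "idx2 TYPE('a)"
  let ?S1 = "{G_row a b c |a b c :: 'a. a \<noteq> b} \<union> {G_col a b c |a b c :: 'a. a \<noteq> b}"
    and ?S3 = "{MVar (i, j) |i j. (i, j) \<in> ?V \<and> i + j > d} :: (nat \<times> nat, 'a) mpoly set"
    and ?S4 = "{\<Prod>(i, j) \<in> {(i, j) \<in> ?V. i + j = d}. (MVar (i, j) ^ (CARD('a) - 1) - 1)}
       :: (nat \<times> nat, 'a) mpoly set"
  have "?S1 \<subseteq> carrier (mpoly_ring ?V)"
    by (auto simp: G_row_def G_col_def idx2_def intro!: mpoly_carrier_FF mpoly_carrier_sum)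
  moreover have "?S4 \<subseteq> carrier (mpoly_ring ?V)"
    by (auto intro!: mpoly_carrier_prod)
  moreover have "?S3 \<subseteq> carrier (mpoly_ring ?V)"
    by auto
  ultimately have *: "?S1 \<subseteq> carrier (mpoly_ring ?V)" "?S3 \<subseteq> carrier (mpoly_ring ?V)"
      "?S4 \<subseteq> carrier (mpoly_ring ?V)"
    by blast+
  show "field_equations_ideal ?V (J_ideal_deg d :: (nat \<times> nat, 'a) mpoly set)"
    by (rule field_equations_ideal_sum[OF finite_idx2 * refl])
       (simp add: J_ideal_deg_def J_ideal_def J_ring_def)
  \<comment> \<open>The product vanishes iff one factor does, that is, iff some coefficient on the
    diagonal i + j = d is nonzero. For d > 2(q - 2) the product is empty, hence 1, and both sides
    are false.\<close>
  have prod: "(\<forall>p\<in>?S4. mpoly_eval s p = 0) \<longleftrightarrow> (\<exists>i j. (i, j) \<in> ?V \<and> i + j = d \<and> s (i, j) \<noteq> 0)"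
    for s :: "nat \<times> nat \<Rightarrow> 'a"
  proof -
    have "finite {(i, j) \<in> ?V. i + j = d}"
      by (rule finite_subset[of _ ?V]) auto
    then show ?thesis
      by (auto simp: case_prod_beta power_card_minus_1_eq_1_iff[simplified])
  qed
  have "zero_set ?V (J_ideal_deg d :: (nat \<times> nat, 'a) mpoly set) =
      {s \<in> ?V \<rightarrow>\<^sub>E UNIV. \<forall>p\<in>?S1 \<union> ?S3 \<union> ?S4. mpoly_eval s p = 0}"
    by (rule zero_set_sum[OF finite_idx2 * refl])
       (simp add: J_ideal_deg_def J_ideal_def J_ring_def)
  also have "\<dots> = {s \<in> ?V \<rightarrow>\<^sub>E UNIV.
         (\<forall>a. bij (\<lambda>x. bieval (point_bipoly s) x a) \<and> bij (\<lambda>y. bieval (point_bipoly s) a y)) \<and>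
         (\<forall>i j. (i, j) \<in> ?V \<and> i + j > d \<longrightarrow> s (i, j) = 0) \<and>
         (\<exists>i j. (i, j) \<in> ?V \<and> i + j = d \<and> s (i, j) \<noteq> 0)}"
  proof -
    have "(\<forall>p\<in>?S1. mpoly_eval s p = 0) \<longleftrightarrow>
        (\<forall>a. bij (\<lambda>x. bieval (point_bipoly s) x a) \<and> bij (\<lambda>y. bieval (point_bipoly s) a y))"
      for s :: "nat \<times> nat \<Rightarrow> 'a"
    proof -
      have "(\<forall>p\<in>?S1. mpoly_eval s p = 0) \<longleftrightarrow>
          (\<forall>a b c. a \<noteq> b \<longrightarrow> mpoly_eval s (G_col a b c) = 0 \<and> mpoly_eval s (G_row a b c) = 0)"
        by blast
      then show ?thesis
        unfolding bij_iff_finite mpoly_eval_G_row mpoly_eval_G_col by blast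
    qed
    moreover have "(\<forall>p\<in>?S3. mpoly_eval s p = 0) \<longleftrightarrow> (\<forall>i j. (i, j) \<in> ?V \<and> i + j > d \<longrightarrow> s (i, j) = 0)"
      for s :: "nat \<times> nat \<Rightarrow> 'a"
    proof -
      have "(\<forall>p\<in>?S3. mpoly_eval s p = 0) \<longleftrightarrow>
          (\<forall>i j. (i, j) \<in> ?V \<and> i + j > d \<longrightarrow> mpoly_eval s (MVar (i, j)) = 0)"
        by blast
      then show ?thesis
        by simp
    qed
    ultimately show ?thesis
      \<comment> \<open>The instances are explicit because \<open>?S1\<close> is itself a union and
        must stay in one piece.\<close>
      by (simp only: ball_Un[of "?S1 \<union> ?S3" ?S4] ball_Un[of ?S1 ?S3] prod conj_assoc)
  qed
  finally show "zero_set ?V (J_ideal_deg d :: (nat \<times> nat, 'a) mpoly set) = \<dots>" .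
qed

text \<open>Fixing one variable gives a univariate permutation polynomial, whose coefficient at q -
  1 is 0. So the coefficient of y^(q-1), a polynomial in x of degree less than q, vanishes
  everywhere and is zero; likewise with x and y exchanged.\<close>

lemma bicoeff_eq_0_if_local_perm:
  fixes f :: "'a::{finite,field} poly poly"
  assumes q: "CARD('a) > 2" and f: "f \<in> local_perm_polys" and ij: "(i, j) \<notin> idx2 TYPE('a)"
  shows "bicoeff f i j = 0"
proof -
  let ?q = "CARD('a)"
  have bound: "i < ?q \<and> j < ?q" if "bicoeff f i j \<noteq> 0" for i j
    using f that by (auto simp: local_perm_polys_def)
  have deg_coeff: "Polynomial.degree (Polynomial.coeff f j) < ?q" for j
    using bound[of "Polynomial.degree (Polynomial.coeff f j)" j] q
    by (cases "Polynomial.coeff f j = 0") (auto simp: bicoeff_def)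
  have coeff_f: "Polynomial.coeff f j = 0" if "j \<ge> ?q" for j
    using bound[of _ j] that by (intro poly_eqI) (force simp: bicoeff_def)
  have deg_f: "Polynomial.degree f < ?q"
    using q by (intro degree_lessI) (auto simp: coeff_f)
  have y: "bicoeff f i (?q - 1) = 0" for i
  proof -
    have "poly (Polynomial.coeff f (?q - 1)) c = 0" for c
    proof -
      \<comment> \<open>\<open>g\<close> is f(c, y) as a polynomial in y, which has to be assembled
        because y is the outer variable.\<close>
      define g where "g = (\<Sum>j<?q. Polynomial.monom (poly (Polynomial.coeff f j) c) j)"
      have coeff_g: "Polynomial.coeff g j = poly (Polynomial.coeff f j) c" for j
        by (auto simp: g_def coeff_sum coeff_f not_less)
      have "poly g y = bieval f c y" for y
        by (simp add: g_def bieval_def poly_eq_sum_lessThan[OF deg_f] poly_sum Polynomial.poly_monom poly_power)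
      then have "bij (poly g)"
        using f by (simp add: local_perm_polys_def bij_iff_finite)
      moreover have "Polynomial.degree g < ?q"
        using q by (intro degree_lessI) (auto simp: coeff_g coeff_f)
      ultimately have "Polynomial.coeff g (?q - 1) = 0"
        using q by (intro coeff_eq_0_if_bij)
      then show ?thesis
        by (simp add: coeff_g)
    qed
    then have "Polynomial.coeff f (?q - 1) = 0"
      by (rule poly_eq_0_if_vanishing[OF deg_coeff])
    then show ?thesis
      by (simp add: bicoeff_def)
  qed
  have x: "bicoeff f (?q - 1) j = 0" for j
  proof -
    \<comment> \<open>\<open>h\<close> is the coefficient of x^(q-1) in \<open>f\<close>, as a
      polynomial in y.\<close>
    define h where "h = (\<Sum>j<?q. Polynomial.monom (bicoeff f (?q - 1) j) j)"
    have coeff_h: "Polynomial.coeff h j = bicoeff f (?q - 1) j" for j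
      using bound[of "?q - 1" j] by (auto simp: h_def coeff_sum)
    have "poly h c = 0" for c
    proof -
      let ?g = "poly f [:c:]"
      have coeff_g: "Polynomial.coeff ?g i = (\<Sum>j<?q. bicoeff f i j * c ^ j)" for i
      proof -
        have "?g = (\<Sum>j<?q. Polynomial.coeff f j * [:c ^ j:])"
          by (simp add: poly_eq_sum_lessThan[OF deg_f] poly_const_pow)
        then show ?thesis
          by (simp add: coeff_sum bicoeff_def mult.commute)
      qed
      have "bij (poly ?g)"
        using f by (simp add: local_perm_polys_def bieval_def)
      moreover have "Polynomial.degree ?g < ?q"
        using q bound by (intro degree_lessI) (force simp: coeff_g intro!: sum.neutral)+
      ultimately have "Polynomial.coeff ?g (?q - 1) = 0"
        using q by (intro coeff_eq_0_if_bij)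
      then show ?thesis
        by (simp add: coeff_g h_def poly_sum Polynomial.poly_monom)
    qed
    moreover have "Polynomial.degree h < ?q"
      using q bound by (intro degree_lessI) (force simp: coeff_h)+
    ultimately have "h = 0"
      by (intro poly_eq_0_if_vanishing)
    then show ?thesis
      using coeff_h[of j] by simp
  qed
  show ?thesis
  proof (rule ccontr)
    assume nz: "bicoeff f i j \<noteq> 0"
    then have "i \<noteq> ?q - 1" "j \<noteq> ?q - 1"
      using x y by auto
    then show False
      using bound[OF nz] ij by (auto simp: idx2_def idx_def)
  qed
qed

text \<open>For nonzero \<open>f\<close> the inserted 0 does not affect the maximum; for
  \<open>f = 0\<close> it would give degree 0 without any nonzero coefficient.\<close>

lemma total_deg_eq_iff:
  assumes "f \<noteq> 0"
  shows "total_deg f = d \<longleftrightarrow> (\<exists>i j. i + j = d \<and> bicoeff f i j \<noteq> 0) \<and> (\<forall>i j. i + j > d \<longrightarrow> bicoeff f i j = 0)"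
proof -
  let ?A = "{i + j |i j. bicoeff f i j \<noteq> 0}"
  \<comment> \<open>Finiteness is needed for \<open>Max\<close> and comes from the degrees in y and
    in x.\<close>
  have "?A \<subseteq> (\<lambda>(j, i). i + j) ` (SIGMA j:{..Polynomial.degree f}. {..Polynomial.degree (Polynomial.coeff f j)})"
    by (force simp: bicoeff_def intro: le_degree)
  then have fin: "finite ?A"
    by (rule finite_subset) auto
  have "?A \<noteq> {}"
    using assms bipoly_eqI[of f 0] by (auto simp: bicoeff_def)
  then have "total_deg f = Max ?A"
    using fin by (simp add: total_deg_def)
  then have "total_deg f = d \<longleftrightarrow> d \<in> ?A \<and> (\<forall>n\<in>?A. n \<le> d)"
    using Max_eq_iff[OF fin \<open>?A \<noteq> {}\<close>] by auto
  also have "\<dots> \<longleftrightarrow> (\<exists>i j. i + j = d \<and> bicoeff f i j \<noteq> 0) \<and> (\<forall>i j. i + j > d \<longrightarrow> bicoeff f i j = 0)"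
    unfolding not_le[symmetric] by blast
  finally show ?thesis .
qed

text \<open>Brings membership into the form of \<open>zero_set_J_ideal_deg\<close>, with the
  exponent bound sharpened from q - 1 to q - 2.\<close>

lemma local_perm_polys_deg_iff:
  fixes f :: "'a::{finite,field} poly poly"
  assumes "CARD('a) > 2"
  shows "f \<in> local_perm_polys_deg d \<longleftrightarrow>
    (\<forall>i j. (i, j) \<notin> idx2 TYPE('a) \<longrightarrow> bicoeff f i j = 0) \<and>
    (\<forall>a. bij (\<lambda>x. bieval f x a) \<and> bij (\<lambda>y. bieval f a y)) \<and>
    (\<exists>i j. i + j = d \<and> bicoeff f i j \<noteq> 0) \<and> (\<forall>i j. i + j > d \<longrightarrow> bicoeff f i j = 0)"
proof -
  have *: "f \<in> local_perm_polys \<longleftrightarrow> (\<forall>i j. (i, j) \<notin> idx2 TYPE('a) \<longrightarrow> bicoeff f i j = 0) \<and>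
      (\<forall>a. bij (\<lambda>x. bieval f x a) \<and> bij (\<lambda>y. bieval f a y))" (is "_ \<longleftrightarrow> ?R")
  proof
    assume f: "f \<in> local_perm_polys"
    show ?R
      using f bicoeff_eq_0_if_local_perm[OF assms f] unfolding local_perm_polys_def by blast
  next
    assume R: ?R
    have "i < CARD('a) \<and> j < CARD('a)" if "bicoeff f i j \<noteq> 0" for i j
    proof -
      have "(i, j) \<in> idx2 TYPE('a)"
        using R that by blast
      then show ?thesis
        using assms by (auto simp: idx2_def idx_def)
    qed
    then show "f \<in> local_perm_polys"
      using R unfolding local_perm_polys_def by blast
  qed
  have "\<not> bij (\<lambda>x. bieval f x 0)" if "f = 0"
    unfolding that bij_iff_finite bieval_def by (metis poly_0 zero_neq_one)
  then have nz: "f \<noteq> 0" if "f \<in> local_perm_polys"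
    using that * by blast
  have "f \<in> local_perm_polys_deg d \<longleftrightarrow> f \<in> local_perm_polys \<and>
      (\<exists>i j. i + j = d \<and> bicoeff f i j \<noteq> 0) \<and> (\<forall>i j. i + j > d \<longrightarrow> bicoeff f i j = 0)"
    unfolding local_perm_polys_deg_def mem_Collect_eq using nz total_deg_eq_iff by metis
  then show ?thesis
    by (simp only: * conj_assoc)
qed

text \<open>Again the inverse reads off coefficients; the sharpened exponent bound ensures that
  those outside \<open>idx2\<close> are zero. For d > 2(q - 2) both sets are empty.\<close>

lemma bij_betw_point_bipoly:
  assumes q: "CARD('a::{finite,field}) > 2"
  shows "bij_betw point_bipoly (zero_set (idx2 TYPE('a)) (J_ideal_deg d))
           (local_perm_polys_deg d :: 'a poly poly set)"
proof (rule bij_betw_byWitness[where f' = "\<lambda>f. restrict (\<lambda>(i, j). bicoeff f i j) (idx2 TYPE('a))"])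
  have inv: "point_bipoly (restrict (\<lambda>(i, j). bicoeff f i j) (idx2 TYPE('a))) = f"
    if "f \<in> local_perm_polys_deg d" for f :: "'a poly poly"
    using that by (intro bipoly_eqI) (auto simp: bicoeff_point_bipoly local_perm_polys_deg_iff[OF q])
  show "\<forall>s\<in>zero_set (idx2 TYPE('a)) (J_ideal_deg d).
      restrict (\<lambda>(i, j). bicoeff (point_bipoly s) i j) (idx2 TYPE('a)) = (s :: nat \<times> nat \<Rightarrow> 'a)"
    by (auto simp: zero_set_J_ideal_deg bicoeff_point_bipoly fun_eq_iff PiE_def extensional_def)
  show "\<forall>f\<in>local_perm_polys_deg d.
      point_bipoly (restrict (\<lambda>(i, j). bicoeff f i j) (idx2 TYPE('a))) = (f :: 'a poly poly)"
    by (simp add: inv)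
  show "point_bipoly ` zero_set (idx2 TYPE('a)) (J_ideal_deg d) \<subseteq> (local_perm_polys_deg d :: 'a poly poly set)"
  proof safe
    fix s :: "nat \<times> nat \<Rightarrow> 'a" assume "s \<in> zero_set (idx2 TYPE('a)) (J_ideal_deg d)"
    note s = this[unfolded zero_set_J_ideal_deg mem_Collect_eq]
    then obtain i j where "(i, j) \<in> idx2 TYPE('a)" "i + j = d" "s (i, j) \<noteq> 0"
      by blast
    then have "\<exists>i j. i + j = d \<and> bicoeff (point_bipoly s) i j \<noteq> 0"
      by (intro exI[of _ i] exI[of _ j]) (simp add: bicoeff_point_bipoly)
    then show "point_bipoly s \<in> local_perm_polys_deg d"
      using s by (simp add: local_perm_polys_deg_iff[OF q] bicoeff_point_bipoly)
  qed
  show "(\<lambda>f. restrict (\<lambda>(i, j). bicoeff f i j) (idx2 TYPE('a))) ` (local_perm_polys_deg d :: 'a poly poly set) \<subseteq>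
      zero_set (idx2 TYPE('a)) (J_ideal_deg d)"
  proof safe
    fix f :: "'a poly poly" assume f: "f \<in> local_perm_polys_deg d"
    note f' = f[unfolded local_perm_polys_deg_iff[OF q]]
    have "\<exists>i j. (i, j) \<in> idx2 TYPE('a) \<and> i + j = d \<and> bicoeff f i j \<noteq> 0"
      using f' by blast
    then show "restrict (\<lambda>(i, j). bicoeff f i j) (idx2 TYPE('a)) \<in> zero_set (idx2 TYPE('a)) (J_ideal_deg d)"
      using f' by (auto simp: zero_set_J_ideal_deg inv[OF f])
  qed
qed

theorem lemma3p2:
  fixes d :: nat
  assumes "CARD('a::{finite,field}) > 3"
  shows
    "(d \<le> CARD('a) - 2 \<longrightarrow>
        zero_dimensional (idx TYPE('a)) (I_ideal_deg d :: (nat, 'a) mpoly set) \<and>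
        radical_ideal I_ring (I_ideal_deg d :: (nat, 'a) mpoly set) \<and>
        bij_betw point_poly
          (zero_set (idx TYPE('a)) (I_ideal_deg d)) (perm_polys_deg d :: 'a poly set) \<and>
        card (perm_polys_deg d :: 'a poly set) =
          card (zero_set (idx TYPE('a)) (I_ideal_deg d :: (nat, 'a) mpoly set)) \<and>
        card (zero_set (idx TYPE('a)) (I_ideal_deg d :: (nat, 'a) mpoly set)) =
          quot_dim (idx TYPE('a)) (I_ideal_deg d :: (nat, 'a) mpoly set)) \<and>
     (zero_dimensional (idx2 TYPE('a)) (J_ideal_deg d :: (nat \<times> nat, 'a) mpoly set) \<and>
        radical_ideal J_ring (J_ideal_deg d :: (nat \<times> nat, 'a) mpoly set) \<and>
        bij_betw point_bipoly
          (zero_set (idx2 TYPE('a)) (J_ideal_deg d)) (local_perm_polys_deg d :: 'a poly poly set) \<and>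
        card (local_perm_polys_deg d :: 'a poly poly set) =
          card (zero_set (idx2 TYPE('a)) (J_ideal_deg d :: (nat \<times> nat, 'a) mpoly set)) \<and>
        card (zero_set (idx2 TYPE('a)) (J_ideal_deg d :: (nat \<times> nat, 'a) mpoly set)) =
          quot_dim (idx2 TYPE('a)) (J_ideal_deg d :: (nat \<times> nat, 'a) mpoly set))"
proof (intro conjI impI)
  assume "d \<le> CARD('a) - 2"
  then have d: "d \<in> idx TYPE('a)"
    by (simp add: idx_def)
  interpret field_equations_ideal "idx TYPE('a)" "I_ideal_deg d :: (nat, 'a) mpoly set"
    using d by (rule field_equations_I_ideal_deg)
  show "zero_dimensional (idx TYPE('a)) (I_ideal_deg d :: (nat, 'a) mpoly set)"
    by (rule zero_dimensional)
  show "radical_ideal I_ring (I_ideal_deg d :: (nat, 'a) mpoly set)"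
    unfolding I_ring_def by (rule radical)
  show bij: "bij_betw point_poly (zero_set (idx TYPE('a)) (I_ideal_deg d)) (perm_polys_deg d :: 'a poly set)"
    using d by (rule bij_betw_point_poly)
  show "card (perm_polys_deg d :: 'a poly set) =
      card (zero_set (idx TYPE('a)) (I_ideal_deg d :: (nat, 'a) mpoly set))"
    using bij_betw_same_card[OF bij] by simp
  show "card (zero_set (idx TYPE('a)) (I_ideal_deg d :: (nat, 'a) mpoly set)) =
      quot_dim (idx TYPE('a)) (I_ideal_deg d :: (nat, 'a) mpoly set)"
    by (simp add: quot_dim_eq)
next
  interpret field_equations_ideal "idx2 TYPE('a)" "J_ideal_deg d :: (nat \<times> nat, 'a) mpoly set"
    by (rule field_equations_J_ideal_deg)
  show "zero_dimensional (idx2 TYPE('a)) (J_ideal_deg d :: (nat \<times> nat, 'a) mpoly set)"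
    by (rule zero_dimensional)
  show "radical_ideal J_ring (J_ideal_deg d :: (nat \<times> nat, 'a) mpoly set)"
    unfolding J_ring_def by (rule radical)
  show bij: "bij_betw point_bipoly (zero_set (idx2 TYPE('a)) (J_ideal_deg d))
      (local_perm_polys_deg d :: 'a poly poly set)"
    using assms by (intro bij_betw_point_bipoly) simp
  show "card (local_perm_polys_deg d :: 'a poly poly set) =
      card (zero_set (idx2 TYPE('a)) (J_ideal_deg d :: (nat \<times> nat, 'a) mpoly set))"
    using bij_betw_same_card[OF bij] by simp
  show "card (zero_set (idx2 TYPE('a)) (J_ideal_deg d :: (nat \<times> nat, 'a) mpoly set)) =
      quot_dim (idx2 TYPE('a)) (J_ideal_deg d :: (nat \<times> nat, 'a) mpoly set)"
    by (simp add: quot_dim_eq)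
qed

end
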